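(* The K process has a unique invariant probability measure $\pi$ on $\bar{\mathbb S}$, given by $$\pi(x)=\begin{cases}\dfrac{\lambda_x\gamma_x}{c+\sum_{y\in\mathbb S}\lambda_y\gamma_y}&\text{if }x\in\mathbb S,\\[2ex] \dfrac{c}{c+\sum_{y\in\mathbb S}\lambda_y\gamma_y}&\text{if }x=\infty.\end{cases}$$
   Context: Let $\mathbb S$ be a countably infinite set, $\infty$ a symbol not in $\mathbb S$, and $\bar{\mathbb S}=\mathbb S\cup\{\infty\}$. The parameters are strictly positive reals $\{\gamma_x,\lambda_x:x\in\mathbb S\}$ and a constant $c\ge 0$, with $\sum_{x\in\mathbb S}\lambda_x=\infty$ and $\sum_{x\in\mathbb S}\lambda_x\gamma_x<\infty$; set $\gamma_\infty=0$. On a probability space $(\Omega,\mathcal F,\mathbb P)$ let the following be independent: a family $\{N_x:x\in\mathbb S\}$ of independent Poisson processes on $\mathbb R^+$, $N_x$ of rate $\lambda_x$ with marks $0<\sigma^x_1<\sigma^x_2<\cdots$ ($N_x(t)$ is the number of marks in $[0,t]$), and a family $\{T_0\}\cup\{T^x_n:n\ge 1,x\in\mathbb S\}$ of i.i.d. exponential random variables of rate $1$. Clock process: for $y\in\bar{\mathbb S}$, $t\ge 0$, $\Gamma^y(t)=\gamma_yT_0+\sum_{z\in\mathbb S}\sum_{i=1}^{N_z(t)}\gamma_zT^z_i+ct$ (empty sums are $0$), and $\Gamma^y(s-)$ denotes its left limit at $s$. K process with initial state $y\in\bar{\mathbb S}$: $X^y(t)=y$ if $t<\gamma_yT_0$;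 $X^y(t)=x$ (with $x\in\mathbb S$) if $t\in\bigcup_{i\ge 1}[\Gamma^y(\sigma^x_i-),\Gamma^y(\sigma^x_i))$; $X^y(t)=\infty$ otherwise. Transition functions: $p_{xy}(t)=\mathbb P(X^x(t)=y)$ for $x,y\in\bar{\mathbb S}$. A probability measure $\mu$ on $\bar{\mathbb S}$ is invariant if $\mu(y)=\sum_{x\in\bar{\mathbb S}}\mu(x)p_{xy}(t)$ for all $y\in\bar{\mathbb S}$ and $t>0$. *)

theory Defs
  imports "HOL-Probability.Probability"
begin

text \<open>The state space is a countably infinite type \<open>'s\<close>; its extension by the extra point is
  \<open>'s option\<close>, with \<open>None\<close> standing for \<open>\<infinity>\<close>. Marks and the exponential variables
  are indexed from 1, and index 0 is never used.\<close>

definition count_marks :: "(nat \<Rightarrow> 'w \<Rightarrow> real) \<Rightarrow> real \<Rightarrow> 'w \<Rightarrow> nat" where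
  "count_marks \<sigma> t \<omega> = card {i. 1 \<le> i \<and> \<sigma> i \<omega> \<le> t}"

text \<open>The sequence of marks is that of a rate \<open>r\<close> Poisson process on the half-line. The marks are
  ordered and locally finite for every \<open>\<omega>\<close>, so that \<open>card\<close> above really counts; the
  increments are independent and Poisson distributed.\<close>

definition poisson_process :: "'w measure \<Rightarrow> real \<Rightarrow> (nat \<Rightarrow> 'w \<Rightarrow> real) \<Rightarrow> bool" where
  "poisson_process M r \<sigma> \<longleftrightarrow>
     (\<forall>\<omega>\<in>space M. 0 < \<sigma> 1 \<omega> \<and> (\<forall>i\<ge>1. \<sigma> i \<omega> < \<sigma> (Suc i) \<omega>)
        \<and> (\<forall>t. finite {i. 1 \<le> i \<and> \<sigma> i \<omega> \<le> t})) \<and>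
     (\<forall>s t. 0 \<le> s \<longrightarrow> s < t \<longrightarrow>
        distr M (count_space UNIV) (\<lambda>\<omega>. count_marks \<sigma> t \<omega> - count_marks \<sigma> s \<omega>)
          = measure_pmf (poisson_pmf (r * (t - s)))) \<and>
     (\<forall>(n::nat) u :: nat \<Rightarrow> real. 0 \<le> u 0 \<longrightarrow> mono u \<longrightarrow>
        prob_space.indep_vars M (\<lambda>_. count_space UNIV)
          (\<lambda>i \<omega>. count_marks \<sigma> (u (Suc i)) \<omega> - count_marks \<sigma> (u i) \<omega>) {..<n})"

text \<open>The whole path of the counting process, as an element of the product space of paths.\<close>

definition path_space :: "(real \<Rightarrow> nat) measure" where
  "path_space = PiM {0..} (\<lambda>_. count_space UNIV)"

definition counting_path :: "(nat \<Rightarrow> 'w \<Rightarrow> real) \<Rightarrow> 'w \<Rightarrow> real \<Rightarrow> nat" where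
  "counting_path \<sigma> \<omega> = (\<lambda>t\<in>{0..}. count_marks \<sigma> t \<omega>)"

text \<open>The family consisting of \<open>T0\<close> (index \<open>None\<close>) and all \<open>T x n\<close> with \<open>n \<ge> 1\<close>.\<close>

definition exp_index :: "('s \<times> nat) option set" where
  "exp_index = insert None (Some ` (UNIV \<times> {1..}))"

definition exp_family :: "('w \<Rightarrow> real) \<Rightarrow> ('s \<Rightarrow> nat \<Rightarrow> 'w \<Rightarrow> real) \<Rightarrow> ('s \<times> nat) option \<Rightarrow> 'w \<Rightarrow> real"
  where "exp_family T0 T j = (case j of None \<Rightarrow> T0 | Some (x, n) \<Rightarrow> T x n)"

text \<open>The Poisson processes are independent of each other, the exponential variables are
  independent of each other, and the two families (that is, the sigma-algebras they generate) are
  independent.\<close>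

definition k_process_inputs ::
  "'w measure \<Rightarrow> ('s \<Rightarrow> real) \<Rightarrow> ('s \<Rightarrow> nat \<Rightarrow> 'w \<Rightarrow> real) \<Rightarrow> ('w \<Rightarrow> real) \<Rightarrow>
   ('s \<Rightarrow> nat \<Rightarrow> 'w \<Rightarrow> real) \<Rightarrow> bool" where
  "k_process_inputs M lam \<sigma> T0 T \<longleftrightarrow>
     (\<forall>x. poisson_process M (lam x) (\<sigma> x)) \<and>
     prob_space.indep_vars M (\<lambda>_. path_space) (\<lambda>x. counting_path (\<sigma> x)) UNIV \<and>
     (\<forall>j\<in>exp_index. distributed M lborel (exp_family T0 T j) (exponential_density 1)) \<and>
     prob_space.indep_vars M (\<lambda>_. borel) (exp_family T0 T) exp_index \<and>
     prob_space.indep_set M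
       (sets (vimage_algebra (space M) (\<lambda>\<omega>. \<lambda>x\<in>UNIV. counting_path (\<sigma> x) \<omega>)
          (PiM UNIV (\<lambda>_. path_space))))
       (sets (vimage_algebra (space M) (\<lambda>\<omega>. \<lambda>j\<in>exp_index. exp_family T0 T j \<omega>)
          (PiM exp_index (\<lambda>_. borel))))"

definition ext_rate :: "('s \<Rightarrow> real) \<Rightarrow> 's option \<Rightarrow> real" where
  "ext_rate \<gamma> y = (case y of None \<Rightarrow> 0 | Some x \<Rightarrow> \<gamma> x)"

text \<open>The clock takes values in \<open>ennreal\<close>: its defining series of nonnegative terms converges
  only almost surely, and on the exceptional null set the clock is \<open>\<infinity>\<close>.\<close>

definition clock ::
  "('s \<Rightarrow> real) \<Rightarrow> real \<Rightarrow> ('s \<Rightarrow> nat \<Rightarrow> 'w \<Rightarrow> real) \<Rightarrow> ('w \<Rightarrow> real) \<Rightarrow> ('s \<Rightarrow> nat \<Rightarrow> 'w \<Rightarrow> real) \<Rightarrow>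
   's option \<Rightarrow> real \<Rightarrow> 'w \<Rightarrow> ennreal" where
  "clock \<gamma> c \<sigma> T0 T y t \<omega> =
     ennreal (ext_rate \<gamma> y * T0 \<omega>)
     + (\<Sum>\<^sub>\<infinity>z\<in>UNIV. \<Sum>i=1..count_marks (\<sigma> z) t \<omega>. ennreal (\<gamma> z * T z i \<omega>))
     + ennreal (c * t)"

definition clock_left ::
  "('s \<Rightarrow> real) \<Rightarrow> real \<Rightarrow> ('s \<Rightarrow> nat \<Rightarrow> 'w \<Rightarrow> real) \<Rightarrow> ('w \<Rightarrow> real) \<Rightarrow> ('s \<Rightarrow> nat \<Rightarrow> 'w \<Rightarrow> real) \<Rightarrow>
   's option \<Rightarrow> real \<Rightarrow> 'w \<Rightarrow> ennreal" where
  "clock_left \<gamma> c \<sigma> T0 T y s \<omega> = Lim (at_left s) (\<lambda>r. clock \<gamma> c \<sigma> T0 T y r \<omega>)"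

definition sojourn ::
  "('s \<Rightarrow> real) \<Rightarrow> real \<Rightarrow> ('s \<Rightarrow> nat \<Rightarrow> 'w \<Rightarrow> real) \<Rightarrow> ('w \<Rightarrow> real) \<Rightarrow> ('s \<Rightarrow> nat \<Rightarrow> 'w \<Rightarrow> real) \<Rightarrow>
   's option \<Rightarrow> 's \<Rightarrow> 'w \<Rightarrow> ennreal set" where
  "sojourn \<gamma> c \<sigma> T0 T y x \<omega> =
     (\<Union>i\<in>{1..}. {clock_left \<gamma> c \<sigma> T0 T y (\<sigma> x i \<omega>) \<omega> ..< clock \<gamma> c \<sigma> T0 T y (\<sigma> x i \<omega>) \<omega>})"

text \<open>Almost surely no two of the Poisson processes share a mark, and then the sojourn sets of
  distinct states are disjoint. Requiring uniqueness of \<open>x\<close> only settles (measurably) the value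
  on the null set where they are not.\<close>

definition k_process ::
  "('s \<Rightarrow> real) \<Rightarrow> real \<Rightarrow> ('s \<Rightarrow> nat \<Rightarrow> 'w \<Rightarrow> real) \<Rightarrow> ('w \<Rightarrow> real) \<Rightarrow> ('s \<Rightarrow> nat \<Rightarrow> 'w \<Rightarrow> real) \<Rightarrow>
   's option \<Rightarrow> real \<Rightarrow> 'w \<Rightarrow> 's option" where
  "k_process \<gamma> c \<sigma> T0 T y t \<omega> =
     (if t < ext_rate \<gamma> y * T0 \<omega> then y
      else if \<exists>!x. ennreal t \<in> sojourn \<gamma> c \<sigma> T0 T y x \<omega>
      then Some (THE x. ennreal t \<in> sojourn \<gamma> c \<sigma> T0 T y x \<omega>)
      else None)"

definition trans_prob ::
  "'w measure \<Rightarrow> ('s \<Rightarrow> real) \<Rightarrow> real \<Rightarrow> ('s \<Rightarrow> nat \<Rightarrow> 'w \<Rightarrow> real) \<Rightarrow> ('w \<Rightarrow> real) \<Rightarrow>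
   ('s \<Rightarrow> nat \<Rightarrow> 'w \<Rightarrow> real) \<Rightarrow> real \<Rightarrow> 's option \<Rightarrow> 's option \<Rightarrow> real" where
  "trans_prob M \<gamma> c \<sigma> T0 T t x y = measure M {\<omega> \<in> space M. k_process \<gamma> c \<sigma> T0 T x t \<omega> = y}"

text \<open>Invariance of a probability measure on a countable state space under a family of transition
  probabilities indexed by positive times.\<close>

definition invariant_pmf :: "(real \<Rightarrow> 'a \<Rightarrow> 'a \<Rightarrow> real) \<Rightarrow> 'a pmf \<Rightarrow> bool" where
  "invariant_pmf p \<mu> \<longleftrightarrow>
     (\<forall>t>0. \<forall>y. ((\<lambda>x. pmf \<mu> x * p t x y) has_sum pmf \<mu> y) UNIV)"

end

theory Submission
  imports Defs
begin

text \<open>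
Write \<open>g x\<close> for \<open>\<gamma> x\<close> and \<open>\<Gamma> y\<close> for the clock started from \<open>y\<close>. Two functions of a level \<open>t\<close> carry the proof:
the expected occupation \<open>U y t\<close>, the mean Lebesgue measure of the set of \<open>s \<ge> 0\<close> with \<open>\<Gamma> y s \<le> t\<close>
(\<open>occupation\<close>), and its discounted version \<open>Q y x t\<close>, where the time \<open>s\<close> is weighted by
\<open>exp (- (t - \<Gamma> y s) / g x)\<close> (\<open>discounted_occupation\<close>).

The first half expresses the transition probabilities through \<open>Q\<close>. The process is at \<open>x\<close> at time \<open>t\<close>
either because it started there and has not yet left, or because \<open>t\<close> lies in a jump interval of the clock that
belongs to a mark of \<open>x\<close>. The \<open>i\<close>-th mark of \<open>x\<close> has an Erlang density, which at \<open>s\<close> equals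
\<open>lam x\<close> times the probability that exactly \<open>i - 1\<close> marks precede \<open>s\<close>, and it is independent of
everything outside the marks of \<open>x\<close>. Summing over \<open>i\<close> turns the sum over the marks of \<open>x\<close> into
\<open>lam x\<close> times an integral over \<open>s\<close>, and the exponential length of the jump contributes the discount factor.
Hence (\<open>trans_prob_Some\<close>)
\<open>p t y (Some x) = [y = Some x] exp (- t / g x) + lam x * Q y x t\<close>.

The second half consists of linear relations. Integrating exponentials gives
\<open>Q y x t + (1 / g x) * (\<integral> Q y x u du over [0, t]) = U y t\<close> and the inverse relation, which recovers
\<open>Q y x\<close> from \<open>U y\<close>. Since \<open>\<Gamma> (Some x)\<close> is \<open>\<Gamma> None\<close> delayed by an independent exponential variable
of mean \<open>g x\<close>, that integral for \<open>y = None\<close>, with its factor \<open>1 / g x\<close>, is \<open>U (Some x) t\<close>. Finally, on almost every path the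
interval \<open>[0, t]\<close> is filled by the jump intervals of the clock and by its continuous growth at rate \<open>c\<close>; in
expectation (\<open>time_balance\<close>)
\<open>t = c * U None t + (\<Sum>x. lam x * g x * U (Some x) t)\<close>.

So the mixture of the \<open>U y\<close> with weights proportional to \<open>c\<close> and \<open>lam x * g x\<close> is \<open>t\<close> divided by the total
weight; the inverse relation yields the corresponding mixture of the \<open>Q y x\<close>, and it is exactly the one that makes the
weights invariant. Conversely, for any invariant \<open>\<mu>\<close> the formula for \<open>p\<close> determines the \<open>\<mu>\<close>-mixture of
the \<open>Q y x\<close>, hence that of the \<open>U y\<close>. At level \<open>1\<close> the latter equals
\<open>\<mu> (Some x) / (lam x * g x)\<close>, while its definition does not mention \<open>x\<close>; so \<open>\<mu> (Some x)\<close> is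
proportional to \<open>lam x * g x\<close>. Comparison with the time balance at level \<open>1\<close> then gives the mass of the extra
point with the same factor.
\<close>

section \<open>Sums as integrals with respect to counting measure\<close>

lemma infsum_ennreal_eq_nn_integral:
  fixes f :: "'a \<Rightarrow> ennreal"
  assumes "countable A" "infinite A"
  shows "infsum f A = (\<integral>\<^sup>+x. f x \<partial>count_space A)"
proof -
  have bij: "bij_betw (from_nat_into A) UNIV A"
    using assms by (rule bij_betw_from_nat_into)
  have "infsum f A = infsum (\<lambda>n. f (from_nat_into A n)) UNIV"
    using infsum_reindex_bij_betw[OF bij, of f] by simp
  also have "\<dots> = (\<Sum>n. f (from_nat_into A n))"
    by (intro sums_unique has_sum_imp_sums has_sum_infsum nonneg_summable_on_complete) simp
  also have "\<dots> = (\<integral>\<^sup>+n. f (from_nat_into A n) \<partial>count_space UNIV)"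
    by (simp add: nn_integral_count_space_nat)
  also have "\<dots> = (\<integral>\<^sup>+x. f x \<partial>count_space A)"
    by (rule nn_integral_bij_count_space[OF bij])
  finally show ?thesis .
qed

lemma has_sum_iff_nn_integral:
  fixes f :: "'a \<Rightarrow> real"
  assumes "countable A" "infinite A" and nonneg: "\<And>x. 0 \<le> f x" and "0 \<le> s"
  shows "(f has_sum s) A \<longleftrightarrow> (\<integral>\<^sup>+x. ennreal (f x) \<partial>count_space A) = ennreal s"
proof -
  have "((\<lambda>x. ennreal (f x)) has_sum ennreal s) A \<longleftrightarrow> (f has_sum s) A"
    using nonneg \<open>0 \<le> s\<close> unfolding has_sum_def
    by (subst tendsto_ennreal_iff[symmetric]) (auto intro!: sum_nonneg always_eventually arg_cong2[where f="\<lambda>x y. filterlim x y _"])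
  moreover have "((\<lambda>x. ennreal (f x)) has_sum ennreal s) A \<longleftrightarrow> infsum (\<lambda>x. ennreal (f x)) A = ennreal s"
  proof
    have "((\<lambda>x. ennreal (f x)) has_sum infsum (\<lambda>x. ennreal (f x)) A) A"
      by (intro has_sum_infsum nonneg_summable_on_complete) simp
    then show "((\<lambda>x. ennreal (f x)) has_sum ennreal s) A" if "infsum (\<lambda>x. ennreal (f x)) A = ennreal s"
      using that by simp
  qed (rule infsumI)
  ultimately show ?thesis
    using infsum_ennreal_eq_nn_integral[OF assms(1,2), of "\<lambda>x. ennreal (f x)"] by simp
qed

lemma nn_integral_count_space_option:
  fixes h :: "'a option \<Rightarrow> ennreal"
  shows "(\<integral>\<^sup>+z. h z \<partial>count_space UNIV) = h None + (\<integral>\<^sup>+x. h (Some x) \<partial>count_space UNIV)"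
proof -
  have "(\<integral>\<^sup>+z. h z \<partial>count_space UNIV)
      = (\<integral>\<^sup>+z. h None * indicator {None} z + h z * indicator (range Some) z \<partial>count_space UNIV)"
    by (intro nn_integral_cong) (auto simp: indicator_def split: option.splits)
  also have "\<dots> = h None + (\<integral>\<^sup>+z. h z \<partial>count_space (range Some))"
    by (subst nn_integral_add) (auto simp: nn_integral_cmult_indicator nn_integral_count_space_indicator)
  also have "(\<integral>\<^sup>+z. h z \<partial>count_space (range Some)) = (\<integral>\<^sup>+x. h (Some x) \<partial>count_space UNIV)"
    by (rule nn_integral_bij_count_space[symmetric]) (simp add: bij_betw_def)
  finally show ?thesis .
qed

lemma borel_measurable_nn_integral_count_space:
  fixes f :: "'i \<Rightarrow> 'a \<Rightarrow> ennreal"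
  assumes "countable (UNIV :: 'i set)" and f: "\<And>i. f i \<in> borel_measurable N"
  shows "(\<lambda>x. \<integral>\<^sup>+i. f i x \<partial>count_space UNIV) \<in> borel_measurable N"
proof -
  interpret sigma_finite_measure "count_space (UNIV :: 'i set)"
    by (rule sigma_finite_measure_count_space_countable) fact
  have "(\<lambda>(i, x). f i x) \<in> borel_measurable (count_space UNIV \<Otimes>\<^sub>M N)"
    using assms by (intro measurable_pair_measure_countable1) simp_all
  then have "(\<lambda>(x, i). f i x) \<in> borel_measurable (N \<Otimes>\<^sub>M count_space UNIV)"
    by (subst measurable_pair_swap_iff) (simp add: split_beta')
  then show ?thesis by (rule borel_measurable_nn_integral)
qed

lemma borel_measurable_nn_integral_swapped:
  assumes "sigma_finite_measure N" "f \<in> borel_measurable (N \<Otimes>\<^sub>M K)"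
  shows "(\<lambda>y. \<integral>\<^sup>+x. f (x, y) \<partial>N) \<in> borel_measurable K"
proof -
  have "(\<lambda>(y, x). f (x, y)) \<in> borel_measurable (K \<Otimes>\<^sub>M N)"
    using assms(2) by (subst measurable_pair_swap_iff) (simp add: split_beta')
  then show ?thesis by (rule sigma_finite_measure.borel_measurable_nn_integral[OF assms(1)])
qed

lemma ennreal_add_cancel_right: "r \<noteq> \<infinity> \<Longrightarrow> a + r = b + r \<Longrightarrow> a = (b :: ennreal)"
  using ennreal_add_left_cancel[of r a b] by (simp add: add.commute)

section \<open>Integration over independent sigma-algebras and Erlang densities\<close>

text \<open>The random variable of interest is integrated out while the path \<open>\<omega>\<close> itself plays the role of the
independent second variable. This way functionals of infinitely many further inputs need no encoding as elements of a product
space: it suffices that they are measurable with respect to \<open>B\<close>.\<close>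

lemma (in prob_space) indep_subalgebras_fubini:
  assumes ind: "indep_set (sets A) (sets B)"
    and sub: "subalgebra M A" "subalgebra M B"
    and X: "X \<in> measurable A N"
    and F: "F \<in> borel_measurable (N \<Otimes>\<^sub>M B)"
  shows "(\<integral>\<^sup>+\<omega>. F (X \<omega>, \<omega>) \<partial>M) = (\<integral>\<^sup>+\<omega>'. \<integral>\<^sup>+\<omega>. F (X \<omega>', \<omega>) \<partial>M \<partial>M)"
proof -
  have XM [measurable]: "X \<in> measurable M N"
    using X sub(1) by (rule measurable_from_subalg[rotated])
  have idM [measurable]: "(\<lambda>\<omega>. \<omega>) \<in> measurable M B"
    using sub(2) by (auto simp: measurable_def subalgebra_def)
  note F [measurable]
  interpret PX: prob_space "distr M N X" by (rule prob_space_distr) measurable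
  interpret PB: prob_space "distr M B (\<lambda>\<omega>. \<omega>)" by (rule prob_space_distr) measurable
  have D: "distr M N X \<Otimes>\<^sub>M distr M B (\<lambda>\<omega>. \<omega>) = distr M (N \<Otimes>\<^sub>M B) (\<lambda>x. (X x, x))"
  proof (rule pair_measure_eqI)
    show "sigma_finite_measure (distr M N X)" "sigma_finite_measure (distr M B (\<lambda>\<omega>. \<omega>))"
      by unfold_locales
    show "sets (distr M N X \<Otimes>\<^sub>M distr M B (\<lambda>\<omega>. \<omega>)) = sets (distr M (N \<Otimes>\<^sub>M B) (\<lambda>x. (X x, x)))"
      by (simp cong: sets_pair_measure_cong)
    fix a b assume a: "a \<in> sets (distr M N X)" and b: "b \<in> sets (distr M B (\<lambda>\<omega>. \<omega>))"
    have a': "X -` a \<inter> space M \<in> sets A"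
      using measurable_sets[OF X, of a] a sub(1) by (simp add: subalgebra_def)
    have b': "b \<in> sets B" "b \<subseteq> space M"
      using b sub(2) sets.sets_into_space[of b B] by (auto simp: subalgebra_def)
    then have "(\<lambda>\<omega>. \<omega>) -` b \<inter> space M = b" by auto
    moreover have "(\<lambda>x. (X x, x)) -` (a \<times> b) \<inter> space M = (X -` a \<inter> space M) \<inter> b"
      using b' by auto
    moreover have "prob ((X -` a \<inter> space M) \<inter> b) = prob (X -` a \<inter> space M) * prob b"
      using ind a' b' unfolding indep_sets2_eq by blast
    ultimately show "emeasure (distr M N X) a * emeasure (distr M B (\<lambda>\<omega>. \<omega>)) b
        = emeasure (distr M (N \<Otimes>\<^sub>M B) (\<lambda>x. (X x, x))) (a \<times> b)"
      using a b by (simp add: emeasure_distr emeasure_eq_measure ennreal_mult measure_nonneg)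
  qed
  have "(\<integral>\<^sup>+\<omega>. F (X \<omega>, \<omega>) \<partial>M) = (\<integral>\<^sup>+p. F p \<partial>distr M (N \<Otimes>\<^sub>M B) (\<lambda>x. (X x, x)))"
    by (subst nn_integral_distr) auto
  also have "\<dots> = (\<integral>\<^sup>+p. F p \<partial>(distr M N X \<Otimes>\<^sub>M distr M B (\<lambda>\<omega>. \<omega>)))"
    by (simp add: D)
  also have "\<dots> = (\<integral>\<^sup>+x. \<integral>\<^sup>+y. F (x, y) \<partial>distr M B (\<lambda>\<omega>. \<omega>) \<partial>distr M N X)"
    by (subst PB.nn_integral_fst[symmetric]) auto
  also have "\<dots> = (\<integral>\<^sup>+x. \<integral>\<^sup>+\<omega>. F (x, \<omega>) \<partial>M \<partial>distr M N X)"
    by (intro nn_integral_cong, subst nn_integral_distr) auto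
  also have "\<dots> = (\<integral>\<^sup>+\<omega>'. \<integral>\<^sup>+\<omega>. F (X \<omega>', \<omega>) \<partial>M \<partial>M)"
  proof -
    have "(\<lambda>x. \<integral>\<^sup>+\<omega>. F (x, \<omega>) \<partial>distr M B (\<lambda>\<omega>. \<omega>)) \<in> borel_measurable N"
      by measurable
    moreover have "(\<integral>\<^sup>+\<omega>. F (x, \<omega>) \<partial>distr M B (\<lambda>\<omega>. \<omega>)) = (\<integral>\<^sup>+\<omega>. F (x, \<omega>) \<partial>M)" if "x \<in> space N" for x
      using that by (subst nn_integral_distr) auto
    ultimately have "(\<lambda>x. \<integral>\<^sup>+\<omega>. F (x, \<omega>) \<partial>M) \<in> borel_measurable N"
      by (simp cong: measurable_cong)
    then show ?thesis by (subst nn_integral_distr) auto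
  qed
  finally show ?thesis .
qed

text \<open>The link between the density of a mark and the number of earlier marks: this identity turns a sum over marks into an
integral over time.\<close>

lemma erlang_density_eq_poisson:
  assumes "0 < l" "0 < s"
  shows "erlang_density i l s = l * pmf (poisson_pmf (l * s)) i"
  using assms by (simp add: erlang_density_def power_mult_distrib)

lemma erlang_density_total:
  assumes "0 < l" "0 < s"
  shows "(\<integral>\<^sup>+i. ennreal (erlang_density i l s) \<partial>count_space UNIV) = ennreal l"
proof -
  have "(\<integral>\<^sup>+i. ennreal (erlang_density i l s) \<partial>count_space UNIV)
      = (\<integral>\<^sup>+i. ennreal l * ennreal (pmf (poisson_pmf (l * s)) i) \<partial>count_space UNIV)"
    using assms by (intro nn_integral_cong) (simp only: erlang_density_eq_poisson ennreal_mult pmf_nonneg less_imp_le)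
  also have "\<dots> = ennreal l"
    by (simp add: nn_integral_cmult nn_integral_pmf measure_pmf.emeasure_space_1)
  finally show ?thesis .
qed

section \<open>Deterministic clocks with a dense set of jumps\<close>

text \<open>The jumps of size \<open>j m\<close> at the times \<open>s m\<close> may be dense and their sum may be infinite, hence the values in
\<open>ennreal\<close>.\<close>

definition jump_clock :: "('i \<Rightarrow> real) \<Rightarrow> ('i \<Rightarrow> ennreal) \<Rightarrow> ennreal \<Rightarrow> real \<Rightarrow> real \<Rightarrow> ennreal" where
  "jump_clock s j a c r = a + (\<integral>\<^sup>+m. (if s m \<le> r then j m else 0) \<partial>count_space UNIV) + ennreal (c * r)"

text \<open>The left limit of \<open>jump_clock\<close>, in closed form.\<close>

definition jump_clock_left :: "('i \<Rightarrow> real) \<Rightarrow> ('i \<Rightarrow> ennreal) \<Rightarrow> ennreal \<Rightarrow> real \<Rightarrow> real \<Rightarrow> ennreal" where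
  "jump_clock_left s j a c r = a + (\<integral>\<^sup>+m. (if s m < r then j m else 0) \<partial>count_space UNIV) + ennreal (c * r)"

lemma jump_clock_mono: "0 \<le> c \<Longrightarrow> r \<le> r' \<Longrightarrow> jump_clock s j a c r \<le> jump_clock s j a c r'"
  unfolding jump_clock_def
  by (intro add_mono nn_integral_mono ennreal_leI mult_left_mono) auto

lemma jump_clock_left_le: "jump_clock_left s j a c r \<le> jump_clock s j a c r"
  unfolding jump_clock_def jump_clock_left_def
  by (intro add_mono nn_integral_mono) auto

lemma jump_clock_le_left:
  "0 \<le> c \<Longrightarrow> r < r' \<Longrightarrow> jump_clock s j a c r \<le> jump_clock_left s j a c r'"
  unfolding jump_clock_def jump_clock_left_def
  by (intro add_mono nn_integral_mono ennreal_leI mult_left_mono) auto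

lemma jump_clock_tendsto_left:
  "(jump_clock s j a c \<longlongrightarrow> jump_clock_left s j a c r) (at_left r)"
proof (rule tendsto_at_left_sequentially[of "r - 1"])
  fix S :: "nat \<Rightarrow> real" assume S: "\<And>n. S n < r" "incseq S" "S \<longlonglongrightarrow> r"
  have "(\<lambda>n. \<integral>\<^sup>+m. (if s m \<le> S n then j m else 0) \<partial>count_space UNIV)
     \<longlonglongrightarrow> (\<integral>\<^sup>+m. (if s m < r then j m else 0) \<partial>count_space UNIV)"
  proof (rule nn_integral_LIMSEQ)
    show "incseq (\<lambda>n m. if s m \<le> S n then j m else 0)"
      using S(2) by (auto simp: incseq_def le_fun_def intro: order_trans)
    fix m
    show "(\<lambda>n. if s m \<le> S n then j m else 0) \<longlonglongrightarrow> (if s m < r then j m else 0)"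
    proof (cases "s m < r")
      case True
      then have "eventually (\<lambda>n. s m < S n) sequentially"
        using S(3) by (rule order_tendstoD(1)[rotated])
      then show ?thesis
        using True by (intro tendsto_eventually) (elim eventually_mono, auto)
    next
      case False
      then have "\<not> s m \<le> S n" for n
        using S(1)[of n] by auto
      then show ?thesis using False by simp
    qed
  qed auto
  then show "(\<lambda>n. jump_clock s j a c (S n)) \<longlonglongrightarrow> jump_clock_left s j a c r"
    unfolding jump_clock_def jump_clock_left_def
    by (intro tendsto_add tendsto_const tendsto_ennrealI tendsto_mult S(3))
qed auto

text \<open>Right continuity needs finiteness: the jumps in a shrinking right neighbourhood form the tail of a convergent sum.\<close>

lemma jump_clock_tendsto_right:
  assumes fin: "\<And>r. jump_clock s j a c r < \<infinity>"
  shows "(jump_clock s j a c \<longlongrightarrow> jump_clock s j a c r) (at_right r)"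
proof (rule tendsto_at_right_sequentially[of _ "r + 1"])
  fix S :: "nat \<Rightarrow> real" assume S: "\<And>n. r < S n" "decseq S" "S \<longlonglongrightarrow> r"
  have "(\<lambda>n. \<integral>\<^sup>+m. (if s m \<le> S n then j m else 0) \<partial>count_space UNIV)
     \<longlonglongrightarrow> (\<integral>\<^sup>+m. (if s m \<le> r then j m else 0) \<partial>count_space UNIV)"
  proof (rule nn_integral_dominated_convergence[where w="\<lambda>m. if s m \<le> S 0 then j m else 0"])
    show "(\<integral>\<^sup>+m. (if s m \<le> S 0 then j m else 0) \<partial>count_space UNIV) < \<infinity>"
      using fin[of "S 0"] by (auto simp: jump_clock_def top.not_eq_extremum)
    show "AE m in count_space UNIV. (if s m \<le> S n then j m else 0) \<le> (if s m \<le> S 0 then j m else 0)" for n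
      using decseqD[OF S(2), of 0 n] by (auto simp: AE_count_space)
    have "(\<lambda>n. if s m \<le> S n then j m else 0) \<longlonglongrightarrow> (if s m \<le> r then j m else 0)" for m
    proof (cases "s m \<le> r")
      case True
      then have "s m \<le> S n" for n
        using S(1)[of n] by auto
      then show ?thesis using True by simp
    next
      case False
      then have "eventually (\<lambda>n. S n < s m) sequentially"
        using order_tendstoD(2)[OF S(3), of "s m"] by auto
      then show ?thesis
        using False by (intro tendsto_eventually) (elim eventually_mono, auto)
    qed
    then show "AE m in count_space UNIV. (\<lambda>n. if s m \<le> S n then j m else 0) \<longlonglongrightarrow> (if s m \<le> r then j m else 0)"
      by simp
  qed auto
  then show "(\<lambda>n. jump_clock s j a c (S n)) \<longlonglongrightarrow> jump_clock s j a c r"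
    unfolding jump_clock_def
    by (intro tendsto_add tendsto_const tendsto_ennrealI tendsto_mult S(3))
qed auto

lemma jump_clock_at_mark:
  assumes "inj s"
  shows "jump_clock s j a c (s m) = jump_clock_left s j a c (s m) + j m"
proof -
  have "(\<integral>\<^sup>+k. (if s k \<le> s m then j k else 0) \<partial>count_space UNIV)
      = (\<integral>\<^sup>+k. (if s k < s m then j k else 0) + j m * indicator {m} k \<partial>count_space UNIV)"
    using assms by (intro nn_integral_cong) (auto simp: inj_def indicator_def dest: order_antisym not_less[THEN iffD1])
  also have "\<dots> = (\<integral>\<^sup>+k. (if s k < s m then j k else 0) \<partial>count_space UNIV) + j m"
    by (subst nn_integral_add) (auto simp: nn_integral_cmult_indicator)
  finally show ?thesis
    by (simp add: jump_clock_def jump_clock_left_def ac_simps)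
qed

lemma nn_integral_ennreal_atLeastLessThan:
  assumes "L \<le> R" "R < \<infinity>" "0 \<le> t"
  shows "(\<integral>\<^sup>+u. indicator {0..t} u * indicator {L..<R} (ennreal u) \<partial>lborel)
    = min R (ennreal t) - min L (ennreal t)"
proof -
  obtain l r where lr: "L = ennreal l" "R = ennreal r" "0 \<le> l" "0 \<le> r"
    using assms(1,2) by (cases L; cases R) (auto simp: top_unique)
  have le: "l \<le> r" using assms(1) lr by simp
  have "(\<integral>\<^sup>+u. indicator {0..t} u * indicator {L..<R} (ennreal u) \<partial>lborel)
      = (\<integral>\<^sup>+u. indicator (if r \<le> t then {l..<r} else {l..t}) u \<partial>lborel)"
    using lr by (intro nn_integral_cong) (auto simp: indicator_def ennreal_less_iff)
  also have "\<dots> = emeasure lborel (if r \<le> t then {l..<r} else {l..t})"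
    by simp
  also have "\<dots> = min R (ennreal t) - min L (ennreal t)"
    using lr le assms(3) by (auto simp: min_def ennreal_minus)
  finally show ?thesis .
qed

text \<open>An interval, of which it is left open whether it contains its right end point.\<close>

lemma borel_between_intervals:
  fixes a b :: real
  assumes "\<And>r. a \<le> r \<Longrightarrow> r < b \<Longrightarrow> r \<in> E" "E \<subseteq> {a..b}"
  shows "E \<in> sets borel"
proof -
  have "E = {a..<b} \<union> (E \<inter> {b})"
    using assms by (auto simp: order.order_iff_strict)
  moreover have "E \<inter> {b} \<in> sets borel"
    by (intro borel_closed finite_imp_closed) simp
  ultimately show ?thesis by (metis atLeastLessThan_borel sets.Un)
qed

text \<open>Let \<open>S\<close> be the time at which the clock crosses the level \<open>t\<close>. Its left limit at \<open>S\<close> is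
\<open>c * S\<close> plus all jumps before \<open>S\<close>, whose intervals lie below \<open>t\<close>; what remains between this left limit and
\<open>t\<close> is covered by the single jump at \<open>S\<close>, if there is one. Without such a jump nothing remains, because the clock is
right continuous.\<close>

lemma jump_clock_time_decomposition:
  fixes s :: "'i \<Rightarrow> real"
  assumes c: "0 \<le> c" and t: "0 \<le> t" and inj: "inj s" and pos: "\<And>m. 0 < s m"
    and fin: "\<And>r. jump_clock s j 0 c r < \<infinity>"
    and finS: "emeasure lborel {r. 0 \<le> r \<and> jump_clock s j 0 c r \<le> ennreal t} < \<infinity>"
  shows "ennreal t = ennreal c * emeasure lborel {r. 0 \<le> r \<and> jump_clock s j 0 c r \<le> ennreal t}
    + (\<integral>\<^sup>+m. (\<integral>\<^sup>+u. indicator {0..t} u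
        * indicator {jump_clock_left s j 0 c (s m)..<jump_clock s j 0 c (s m)} (ennreal u) \<partial>lborel) \<partial>count_space UNIV)"
proof -
  let ?f = "jump_clock s j 0 c" and ?l = "jump_clock_left s j 0 c"
  define E where "E = {r. 0 \<le> r \<and> ?f r \<le> ennreal t}"
  have "(\<lambda>m. if s m \<le> 0 then j m else 0) = (\<lambda>m. 0)"
    using pos by (auto simp: fun_eq_iff not_le[symmetric])
  then have E0: "0 \<in> E"
    by (simp add: E_def jump_clock_def)
  have down: "r' \<in> E" if "r \<in> E" "0 \<le> r'" "r' \<le> r" for r r'
    using that jump_clock_mono[OF c, of r' r s j 0] by (auto simp: E_def intro: order_trans)
  obtain e where e: "emeasure lborel E = ennreal e" "0 \<le> e"
    using finS unfolding E_def[symmetric] by (cases "emeasure lborel E") auto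
  have Emeas: "E \<in> sets borel"
  proof (cases "bdd_above E")
    case True
    have "r \<in> E" if r: "0 \<le> r" "r < Sup E" for r :: real
    proof -
      obtain r' where "r' \<in> E" "r < r'"
        using less_cSupD[of E r] E0 r(2) by auto
      then show ?thesis using down r by force
    qed
    moreover have "E \<subseteq> {0..Sup E}"
      using cSup_upper[OF _ True] by (auto simp: E_def)
    ultimately show ?thesis by (rule borel_between_intervals)
  next
    case False
    have "r \<in> E" if "0 \<le> r" for r :: real
      using False down[of _ r] that by (meson bdd_above.I linear)
    then have "E = {0..}" by (auto simp: E_def)
    then show ?thesis by simp
  qed
  have bd: "r \<le> e" if "r \<in> E" for r
  proof -
    have "{0..r} \<subseteq> E" using that down by auto
    then have "emeasure lborel {0..r} \<le> emeasure lborel E"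
      using Emeas by (intro emeasure_mono) auto
    moreover have "0 \<le> r" using that by (simp add: E_def)
    ultimately show ?thesis using e by simp
  qed
  \<comment> \<open>The time at which the clock crosses the level \<open>t\<close>.\<close>
  define S where "S = Sup E"
  have bdd: "bdd_above E" using bd by (auto simp: bdd_above_def)
  have S0: "0 \<le> S" unfolding S_def by (rule cSup_upper[OF E0 bdd])
  have below: "?f r \<le> ennreal t" if r: "0 \<le> r" "r < S" for r
  proof -
    obtain r' where "r' \<in> E" "r < r'"
      using less_cSupD[of E r] E0 r(2) by (auto simp: S_def)
    then have "r \<in> E" using down r by force
    then show ?thesis by (simp add: E_def)
  qed
  have above: "ennreal t < ?f r" if "S < r" for r
  proof (rule ccontr)
    assume "\<not> ?thesis"
    then have "r \<in> E" using that S0 by (auto simp: E_def)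
    then show False using cSup_upper[OF _ bdd, of r] that by (auto simp: S_def)
  qed
  have mE: "emeasure lborel E = ennreal S"
  proof (rule antisym)
    have "emeasure lborel E \<le> emeasure lborel {0..S}"
      using cSup_upper[OF _ bdd] by (intro emeasure_mono) (auto simp: S_def E_def)
    then show "emeasure lborel E \<le> ennreal S" using S0 by simp
    have "emeasure lborel {0..<S} \<le> emeasure lborel E"
      using below Emeas by (intro emeasure_mono) (auto simp: E_def)
    then show "ennreal S \<le> emeasure lborel E" using S0 by simp
  qed
  have lS: "?l S \<le> ennreal t"
  proof (cases "S = 0")
    case True
    then have "?l S \<le> ?f 0" using jump_clock_left_le by metis
    also have "\<dots> \<le> ennreal t" using E0 by (simp add: E_def)
    finally show ?thesis .
  next
    case False
    then have "eventually (\<lambda>r. r \<in> {0<..<S}) (at_left S)"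
      using S0 by (intro eventually_at_leftI[of 0]) auto
    then show ?thesis
      by (intro tendsto_upperbound[OF jump_clock_tendsto_left]) (auto elim!: eventually_mono intro: below)
  qed
  have fS: "ennreal t \<le> ?f S"
  proof (rule tendsto_lowerbound[OF jump_clock_tendsto_right[OF fin]])
    show "eventually (\<lambda>r. ennreal t \<le> ?f r) (at_right S)"
      using above by (intro eventually_at_rightI[of S "S + 1"]) (auto intro: less_imp_le)
  qed simp
  have len: "(\<integral>\<^sup>+u. indicator {0..t} u * indicator {?l (s m)..<?f (s m)} (ennreal u) \<partial>lborel)
      = (if s m < S then j m else 0) + (if s m = S then ennreal t - ?l S else 0)" for m
  proof -
    have "(\<integral>\<^sup>+u. indicator {0..t} u * indicator {?l (s m)..<?f (s m)} (ennreal u) \<partial>lborel)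
        = min (?f (s m)) (ennreal t) - min (?l (s m)) (ennreal t)"
      by (rule nn_integral_ennreal_atLeastLessThan[OF jump_clock_left_le fin t])
    also have "\<dots> = (if s m < S then j m else 0) + (if s m = S then ennreal t - ?l S else 0)"
    proof (cases "s m" S rule: linorder_cases)
      case less
      have 1: "?f (s m) \<le> ennreal t" using less pos[of m] by (intro below) auto
      then have 2: "?l (s m) \<le> ennreal t" using jump_clock_left_le order_trans by blast
      have "?l (s m) \<noteq> \<infinity>" using fin[of "s m"] jump_clock_left_le[of s j 0 c "s m"] by (auto simp: top_unique)
      then have "?f (s m) - ?l (s m) = j m"
        unfolding jump_clock_at_mark[OF inj] by simp
      then show ?thesis using 1 2 less by (simp add: min_absorb1)
    next
      case equal
      then show ?thesis using lS fS by (simp add: min_absorb1 min_absorb2)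
    next
      case greater
      have "ennreal t \<le> ?l (s m)"
        using fS jump_clock_le_left[OF c greater, of s j 0] by (rule order_trans)
      then have "ennreal t \<le> ?f (s m)" using jump_clock_left_le order_trans by blast
      then show ?thesis using \<open>ennreal t \<le> ?l (s m)\<close> greater by (simp add: min_absorb2)
    qed
    finally show ?thesis .
  qed
  have one: "(\<integral>\<^sup>+m. (if s m = S then ennreal t - ?l S else 0) \<partial>count_space UNIV) = ennreal t - ?l S"
  proof (cases "\<exists>m. s m = S")
    case True
    then obtain m where m: "s m = S" by auto
    have "(\<integral>\<^sup>+k. (if s k = S then ennreal t - ?l S else 0) \<partial>count_space UNIV)
        = (\<integral>\<^sup>+k. (ennreal t - ?l S) * indicator {m} k \<partial>count_space UNIV)"
      using inj m by (intro nn_integral_cong) (auto simp: inj_def indicator_def)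
    then show ?thesis by (simp add: nn_integral_cmult_indicator)
  next
    case False
    then have "(\<lambda>m. if s m \<le> S then j m else 0) = (\<lambda>m. if s m < S then j m else 0)"
      by (auto simp: fun_eq_iff order.order_iff_strict)
    then have "?f S = ?l S" by (simp add: jump_clock_def jump_clock_left_def)
    then have "ennreal t = ?l S" using lS fS by simp
    then have "ennreal t - ?l S = 0" by (metis ennreal_diff_self ennreal_neq_top)
    then show ?thesis using False by simp
  qed
  have "(\<integral>\<^sup>+m. (\<integral>\<^sup>+u. indicator {0..t} u * indicator {?l (s m)..<?f (s m)} (ennreal u) \<partial>lborel) \<partial>count_space UNIV)
     = (\<integral>\<^sup>+m. (if s m < S then j m else 0) \<partial>count_space UNIV) + (ennreal t - ?l S)"
    unfolding len by (subst nn_integral_add) (auto simp: one)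
  moreover have "ennreal c * ennreal S + (\<integral>\<^sup>+m. (if s m < S then j m else 0) \<partial>count_space UNIV) = ?l S"
    using c S0 by (simp add: jump_clock_left_def ennreal_mult ac_simps)
  moreover have "?l S + (ennreal t - ?l S) = ennreal t"
    using lS by (rule add_diff_inverse_ennreal)
  ultimately show ?thesis
    unfolding E_def[symmetric] mE by (metis add.assoc)
qed

section \<open>The clock of a K process as a deterministic clock on each path\<close>

locale k_process_setting = prob_space M
  for M :: "'w measure" +
  fixes \<gamma> lam :: "'s \<Rightarrow> real" and c :: real
    and \<sigma> T :: "'s \<Rightarrow> nat \<Rightarrow> 'w \<Rightarrow> real" and T0 :: "'w \<Rightarrow> real"
  assumes countable_states: "countable (UNIV :: 's set)" and infinite_states: "infinite (UNIV :: 's set)"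
    and \<gamma>_pos: "\<And>x. 0 < \<gamma> x" and lam_pos: "\<And>x. 0 < lam x" and c_nonneg: "0 \<le> c"
    and summable_rates: "(\<lambda>x. lam x * \<gamma> x) summable_on UNIV"
    and inputs: "k_process_inputs M lam \<sigma> T0 T"
begin

text \<open>A mark is indexed by its state and its number, counted from \<open>0\<close>; the marks of the process are counted from
\<open>1\<close>, hence the successor.\<close>

definition mark :: "'s \<times> nat \<Rightarrow> 'w \<Rightarrow> real" where
  "mark m \<omega> = \<sigma> (fst m) (Suc (snd m)) \<omega>"

definition jump :: "'s \<times> nat \<Rightarrow> 'w \<Rightarrow> ennreal" where
  "jump m \<omega> = ennreal (\<gamma> (fst m) * T (fst m) (Suc (snd m)) \<omega>)"

definition hold :: "'s option \<Rightarrow> 'w \<Rightarrow> ennreal" where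
  "hold y \<omega> = ennreal (ext_rate \<gamma> y * T0 \<omega>)"

definition \<Gamma> :: "'s option \<Rightarrow> real \<Rightarrow> 'w \<Rightarrow> ennreal" where
  "\<Gamma> y r \<omega> = jump_clock (\<lambda>m. mark m \<omega>) (\<lambda>m. jump m \<omega>) (hold y \<omega>) c r"

definition \<Gamma>_left :: "'s option \<Rightarrow> real \<Rightarrow> 'w \<Rightarrow> ennreal" where
  "\<Gamma>_left y r \<omega> = jump_clock_left (\<lambda>m. mark m \<omega>) (\<lambda>m. jump m \<omega>) (hold y \<omega>) c r"

lemma poisson: "poisson_process M (lam x) (\<sigma> x)"
  using inputs by (simp add: k_process_inputs_def)

lemma mark_pos: "\<omega> \<in> space M \<Longrightarrow> 0 < mark m \<omega>"
proof -
  assume "\<omega> \<in> space M"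
  then have p: "0 < \<sigma> (fst m) 1 \<omega>" "\<And>i. 1 \<le> i \<Longrightarrow> \<sigma> (fst m) i \<omega> < \<sigma> (fst m) (Suc i) \<omega>"
    using poisson[of "fst m"] by (auto simp: poisson_process_def)
  have "0 < \<sigma> (fst m) (Suc n) \<omega>" for n
  proof (induction n)
    case (Suc n) then show ?case using p(2)[of "Suc n"] by simp
  qed (use p(1) in simp)
  then show ?thesis by (simp add: mark_def)
qed

lemma mark_less_iff: "\<omega> \<in> space M \<Longrightarrow> mark (x, i) \<omega> < mark (x, k) \<omega> \<longleftrightarrow> i < k"
proof -
  assume "\<omega> \<in> space M"
  then have "strict_mono (\<lambda>n. \<sigma> x (Suc n) \<omega>)"
    using poisson[of x] by (auto simp: poisson_process_def strict_mono_Suc_iff)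
  from strict_mono_less[OF this, of i k] show ?thesis by (simp add: mark_def)
qed

lemma mark_le_iff: 
  assumes \<omega>: "\<omega> \<in> space M" 
  shows "mark (x, i) \<omega> \<le> r \<longleftrightarrow> i < count_marks (\<sigma> x) r \<omega>"
proof -
  define A where "A = {i. mark (x, i) \<omega> \<le> r}"
  have eq: "{i. 1 \<le> i \<and> \<sigma> x i \<omega> \<le> r} = Suc ` A"
  proof (safe)
    fix i assume "1 \<le> i" "\<sigma> x i \<omega> \<le> r"
    then show "i \<in> Suc ` A" by (cases i) (auto simp: A_def mark_def)
  qed (auto simp: A_def mark_def)
  have "finite {i. 1 \<le> i \<and> \<sigma> x i \<omega> \<le> r}"
    using poisson[of x] \<omega> by (auto simp: poisson_process_def)
  then have fin: "finite A" unfolding eq by (auto dest: finite_imageD)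
  have cnt: "count_marks (\<sigma> x) r \<omega> = card A"
    unfolding count_marks_def eq by (simp add: card_image)
  have down: "k \<in> A" if "i \<in> A" "k \<le> i" for i k
    using that mark_less_iff[OF \<omega>, of x k i] by (cases "k = i") (auto simp: A_def)
  have "A = {..<card A}"
  proof (cases "A = {}")
    case False
    have "A = {..Max A}" using fin False down by (auto intro: Max_ge Max_in)
    then show ?thesis by (metis card_atMost lessThan_Suc_atMost)
  qed simp
  then show ?thesis unfolding cnt by (auto simp: A_def)
qed

text \<open>Both sums over the marks of a path, by states and by all marks at once, agree, so the deterministic results apply.\<close>

lemma clock_eq: "\<omega> \<in> space M \<Longrightarrow> clock \<gamma> c \<sigma> T0 T y r \<omega> = \<Gamma> y r \<omega>"
proof -
  assume \<omega>: "\<omega> \<in> space M"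
  have inner: "(\<Sum>i=1..count_marks (\<sigma> z) r \<omega>. ennreal (\<gamma> z * T z i \<omega>))
      = (\<integral>\<^sup>+i. (if mark (z, i) \<omega> \<le> r then jump (z, i) \<omega> else 0) \<partial>count_space UNIV)" for z
  proof -
    have "(\<integral>\<^sup>+i. (if mark (z, i) \<omega> \<le> r then jump (z, i) \<omega> else 0) \<partial>count_space UNIV)
       = (\<Sum>i<count_marks (\<sigma> z) r \<omega>. if mark (z, i) \<omega> \<le> r then jump (z, i) \<omega> else 0)"
      using mark_le_iff[OF \<omega>] by (intro nn_integral_count_space') auto
    also have "\<dots> = (\<Sum>i<count_marks (\<sigma> z) r \<omega>. ennreal (\<gamma> z * T z (Suc i) \<omega>))"
      using mark_le_iff[OF \<omega>] by (intro sum.cong) (auto simp: jump_def)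
    also have "\<dots> = (\<Sum>i=1..count_marks (\<sigma> z) r \<omega>. ennreal (\<gamma> z * T z i \<omega>))"
      by (simp add: sum.atLeast1_atMost_eq)
    finally show ?thesis ..
  qed
  show ?thesis
    unfolding clock_def \<Gamma>_def jump_clock_def hold_def inner
    unfolding infsum_ennreal_eq_nn_integral[OF countable_states infinite_states]
    using nn_integral_fst_count_space[of "\<lambda>m. if mark m \<omega> \<le> r then jump m \<omega> else 0"]
    by simp
qed

lemma clock_left_eq: "\<omega> \<in> space M \<Longrightarrow> clock_left \<gamma> c \<sigma> T0 T y r \<omega> = \<Gamma>_left y r \<omega>"
  unfolding clock_left_def \<Gamma>_left_def using jump_clock_tendsto_left
  by (intro tendsto_Lim) (simp_all add: clock_eq \<Gamma>_def[abs_def])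

section \<open>Independence of one input from all the others\<close>

text \<open>One index for every independent input: a Poisson process for each state, and the exponential variables.\<close>

definition input_index :: "('s + ('s \<times> nat) option) set" where
  "input_index = range Inl \<union> Inr ` exp_index"

text \<open>The sigma-algebra generated by a single input. A family of sigma-algebras, unlike a family of random variables, can combine
inputs with values in different spaces.\<close>

definition own_alg :: "'s + ('s \<times> nat) option \<Rightarrow> 'w measure" where
  "own_alg k = (case k of Inl x \<Rightarrow> vimage_algebra (space M) (counting_path (\<sigma> x)) path_space
    | Inr j \<Rightarrow> vimage_algebra (space M) (exp_family T0 T j) borel)"

text \<open>The sigma-algebra generated by all inputs other than \<open>k\<close>.\<close>

definition rest_alg :: "'s + ('s \<times> nat) option \<Rightarrow> 'w measure" where
  "rest_alg k = sigma (space M) (\<Union>l\<in>input_index - {k}. sets (own_alg l))"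

lemma space_own_alg [simp]: "space (own_alg k) = space M"
  by (auto simp: own_alg_def split: sum.split)

lemma space_rest_alg [simp]: "space (rest_alg k) = space M"
  by (simp add: rest_alg_def space_measure_of_conv)

lemma counting_path_space: "counting_path s \<omega> \<in> space path_space"
  by (simp add: counting_path_def path_space_def space_PiM)

text \<open>A finite intersection splits into a part from the Poisson processes and a part from the exponential variables. These are
independent of each other, and each part factorises within its own family.\<close>

lemma indep_own_alg: "indep_sets (\<lambda>k. sets (own_alg k)) input_index"
proof (rule indep_setsI)
  let ?N = "\<lambda>\<omega>. \<lambda>x\<in>UNIV. counting_path (\<sigma> x) \<omega>"
  let ?T = "\<lambda>\<omega>. \<lambda>j\<in>exp_index. exp_family T0 T j \<omega>"
  let ?VN = "vimage_algebra (space M) ?N (PiM UNIV (\<lambda>_. path_space))"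
  let ?VT = "vimage_algebra (space M) ?T (PiM exp_index (\<lambda>_. borel :: real measure))"
  have N: "indep_vars (\<lambda>_. path_space) (\<lambda>x. counting_path (\<sigma> x)) UNIV"
    and T: "indep_vars (\<lambda>_. borel) (exp_family T0 T) exp_index"
    and NT: "indep_set (sets ?VN) (sets ?VT)"
    using inputs by (auto simp: k_process_inputs_def)
  have eN: "sets (own_alg (Inl x)) = {counting_path (\<sigma> x) -` A \<inter> space M | A. A \<in> sets path_space}" for x
    unfolding own_alg_def by (simp, rule sets_vimage_algebra2) (simp add: counting_path_space)
  have eT: "sets (own_alg (Inr j)) = {exp_family T0 T j -` A \<inter> space M | A. A \<in> sets borel}" for j
    unfolding own_alg_def by (simp, rule sets_vimage_algebra2) simp
  have IN: "indep_sets (\<lambda>x. sets (own_alg (Inl x))) UNIV"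
    using N unfolding indep_vars_def2 eN by simp
  have IT: "indep_sets (\<lambda>j. sets (own_alg (Inr j))) exp_index"
    using T unfolding indep_vars_def2 eT by simp
  have subN: "sets (own_alg (Inl x)) \<subseteq> sets ?VN" for x
  proof -
    have "?N \<in> measurable ?VN (PiM UNIV (\<lambda>_. path_space))"
      by (rule measurable_vimage_algebra1) (auto simp: space_PiM counting_path_space)
    from measurable_compose[OF this measurable_component_singleton[of x]]
    have "counting_path (\<sigma> x) \<in> measurable ?VN path_space" by simp
    then show ?thesis unfolding eN by (auto dest: measurable_sets)
  qed
  have subT: "sets (own_alg (Inr j)) \<subseteq> sets ?VT" if "j \<in> exp_index" for j
  proof -
    have "?T \<in> measurable ?VT (PiM exp_index (\<lambda>_. borel))"
      by (rule measurable_vimage_algebra1) (auto simp: space_PiM)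
    from measurable_compose[OF this measurable_component_singleton[OF that]] that
    have "exp_family T0 T j \<in> measurable ?VT borel" by simp
    then show ?thesis unfolding eT by (auto dest: measurable_sets)
  qed
  have ev: "sets ?VN \<subseteq> events" "sets ?VT \<subseteq> events"
    using NT unfolding indep_sets2_eq by auto
  show "sets (own_alg k) \<subseteq> events" if "k \<in> input_index" for k
  proof -
    from that consider x where "k = Inl x" | j where "j \<in> exp_index" "k = Inr j"
      unfolding input_index_def by blast
    then show ?thesis
      by cases (simp_all add: order_trans[OF subN ev(1)] order_trans[OF subT ev(2)])
  qed
  fix A J assume J: "J \<noteq> {}" "J \<subseteq> input_index" "finite J" and A: "\<forall>j\<in>J. A j \<in> sets (own_alg j)"
  define J1 where "J1 = {x. Inl x \<in> J}"
  define J2 where "J2 = {j. Inr j \<in> J}"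
  have Jeq: "J = Inl ` J1 \<union> Inr ` J2"
  proof (safe)
    fix k assume "k \<in> J" "k \<notin> Inr ` J2"
    then show "k \<in> Inl ` J1" by (cases k) (auto simp: J1_def J2_def)
  qed (auto simp: J1_def J2_def)
  have fin: "finite J1" "finite J2"
    using J(3) unfolding Jeq by (auto dest: finite_imageD)
  have J2: "J2 \<subseteq> exp_index" using J(2) by (auto simp: J2_def input_index_def)
  define B1 where "B1 = space M \<inter> (\<Inter>x\<in>J1. A (Inl x))"
  define B2 where "B2 = space M \<inter> (\<Inter>j\<in>J2. A (Inr j))"
  have A1: "A (Inl x) \<in> sets (own_alg (Inl x))" if "x \<in> J1" for x using A that by (auto simp: J1_def)
  have A2: "A (Inr x) \<in> sets (own_alg (Inr x))" if "x \<in> J2" for x using A that by (auto simp: J2_def)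
  have sp: "A j \<subseteq> space M" if "j \<in> J" for j
    using A that sets.sets_into_space by fastforce
  have B1: "B1 \<in> sets ?VN"
  proof (cases "J1 = {}")
    case True then show ?thesis using sets.top[of ?VN] by (simp add: B1_def)
  next
    case False
    have "(\<Inter>x\<in>J1. A (Inl x)) \<in> sets ?VN"
      using fin False A1 subN by (intro sets.finite_INT) auto
    then show ?thesis using sets.Int[OF sets.top[of ?VN]] by (simp add: B1_def)
  qed
  have B2: "B2 \<in> sets ?VT"
  proof (cases "J2 = {}")
    case True then show ?thesis using sets.top[of ?VT] by (simp add: B2_def)
  next
    case False
    have "(\<Inter>x\<in>J2. A (Inr x)) \<in> sets ?VT"
      using fin False A2 subT J2 by (intro sets.finite_INT) auto
    then show ?thesis using sets.Int[OF sets.top[of ?VT]] by (simp add: B2_def)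
  qed
  have P1: "prob B1 = (\<Prod>x\<in>J1. prob (A (Inl x)))"
  proof (cases "J1 = {}")
    case True then show ?thesis by (simp add: B1_def prob_space)
  next
    case False
    then have "B1 = (\<Inter>x\<in>J1. A (Inl x))" using sp by (auto simp: B1_def J1_def)
    then show ?thesis using indep_setsD[OF IN, of J1 "\<lambda>x. A (Inl x)"] fin False A1 by simp
  qed
  have P2: "prob B2 = (\<Prod>x\<in>J2. prob (A (Inr x)))"
  proof (cases "J2 = {}")
    case True then show ?thesis by (simp add: B2_def prob_space)
  next
    case False
    then have "B2 = (\<Inter>x\<in>J2. A (Inr x))" using sp by (auto simp: B2_def J2_def)
    then show ?thesis using indep_setsD[OF IT, of J2 "\<lambda>x. A (Inr x)"] fin False A2 J2 by simp
  qed
  have "(\<Inter>j\<in>J. A j) = B1 \<inter> B2"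
  proof -
    have "(\<Inter>j\<in>J. A j) = space M \<inter> (\<Inter>j\<in>J. A j)" using J(1) sp by blast
    also have "\<dots> = B1 \<inter> B2" unfolding Jeq B1_def B2_def by auto
    finally show ?thesis .
  qed
  moreover have "prob (B1 \<inter> B2) = prob B1 * prob B2"
    using NT B1 B2 unfolding indep_sets2_eq by blast
  moreover have "(\<Prod>j\<in>J. prob (A j)) = (\<Prod>x\<in>J1. prob (A (Inl x))) * (\<Prod>x\<in>J2. prob (A (Inr x)))"
    unfolding Jeq using fin by (subst prod.union_disjoint) (auto simp: prod.reindex)
  ultimately show "prob (\<Inter>j\<in>J. A j) = (\<Prod>j\<in>J. prob (A j))"
    by (simp add: P1 P2)
qed

lemma subalgebra_own_alg: "k \<in> input_index \<Longrightarrow> subalgebra M (own_alg k)"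
  using indep_own_alg by (auto simp: subalgebra_def indep_sets_def)

lemma rest_alg_sets: "sets (rest_alg k) = sigma_sets (space M) (\<Union>l\<in>input_index - {k}. sets (own_alg l))"
  unfolding rest_alg_def using sets.sets_into_space by (intro sets_measure_of) fastforce

lemma subalgebra_rest_alg: "subalgebra M (rest_alg k)"
  using subalgebra_own_alg unfolding subalgebra_def rest_alg_sets
  by (auto intro!: sets.sigma_sets_subset)

lemma measurable_rest_alg:
  assumes "f \<in> measurable (own_alg l) N" "l \<in> input_index" "l \<noteq> k"
  shows "f \<in> measurable (rest_alg k) N"
proof (rule measurable_from_subalg[OF _ assms(1)])
  show "subalgebra (rest_alg k) (own_alg l)"
    using assms(2,3) unfolding subalgebra_def rest_alg_sets by auto
qed

lemma indep_own_rest: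
  assumes "k \<in> input_index"
  shows "indep_set (sets (own_alg k)) (sets (rest_alg k))"
proof -
  let ?I = "case_bool {k} (input_index - {k})"
  have U: "(\<Union>b\<in>UNIV. ?I b) = input_index" using assms by (auto simp: UNIV_bool)
  have "indep_sets (\<lambda>b. sigma_sets (space M) (\<Union>i\<in>?I b. sets (own_alg i))) UNIV"
    by (rule indep_sets_collect_sigma)
      (auto simp: U indep_own_alg disjoint_family_on_def Int_stable_def split: bool.splits)
  then show ?thesis
    unfolding indep_set_def
    by (rule indep_sets_mono_sets)
      (auto simp: rest_alg_sets split: bool.splits)
qed

lemma Inl_index [simp]: "Inl x \<in> input_index" by (simp add: input_index_def)

lemma Inr_index [simp]: "Inr None \<in> input_index" "Inr (Some (x, Suc i)) \<in> input_index"
  by (auto simp: input_index_def exp_index_def)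

lemma measurable_count_own:
  assumes "0 \<le> t" shows "count_marks (\<sigma> x) t \<in> measurable (own_alg (Inl x)) (count_space UNIV)"
proof -
  have "counting_path (\<sigma> x) \<in> measurable (own_alg (Inl x)) path_space"
    unfolding own_alg_def by (simp, rule measurable_vimage_algebra1) (simp add: counting_path_space)
  then have "(\<lambda>\<omega>. counting_path (\<sigma> x) \<omega> t) \<in> measurable (own_alg (Inl x)) (count_space UNIV)"
    unfolding path_space_def by (rule measurable_compose) (use assms in simp)
  then show ?thesis using assms by (simp add: counting_path_def)
qed

text \<open>A mark is recovered from the counting path: the mark number \<open>i\<close> is at most \<open>a\<close> iff more than \<open>i\<close>
marks have been counted up to \<open>a\<close>.\<close>

lemma measurable_mark_own: "mark (x, i) \<in> borel_measurable (own_alg (Inl x))"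
  unfolding borel_measurable_iff_le
proof
  fix a
  show "{\<omega> \<in> space (own_alg (Inl x)). mark (x, i) \<omega> \<le> a} \<in> sets (own_alg (Inl x))"
  proof (cases "0 \<le> a")
    case True
    note [measurable] = measurable_count_own[OF True, of x]
    have "{\<omega> \<in> space (own_alg (Inl x)). mark (x, i) \<omega> \<le> a}
        = {\<omega> \<in> space (own_alg (Inl x)). i < count_marks (\<sigma> x) a \<omega>}"
      using mark_le_iff by auto
    also have "\<dots> \<in> sets (own_alg (Inl x))" by measurable
    finally show ?thesis .
  next
    case False
    then have "{\<omega> \<in> space (own_alg (Inl x)). mark (x, i) \<omega> \<le> a} = {}"
      by (auto dest: mark_pos[of _ "(x, i)"])
    then show ?thesis by (metis sets.empty_sets)
  qed
qed

lemma measurable_exp_own: "exp_family T0 T j \<in> borel_measurable (own_alg (Inr j))"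
  unfolding own_alg_def by (simp, rule measurable_vimage_algebra1) simp

lemma measurable_jump_own: "jump (x, i) \<in> borel_measurable (own_alg (Inr (Some (x, Suc i))))"
  using measurable_exp_own[of "Some (x, Suc i)"] unfolding jump_def[abs_def] exp_family_def by simp

lemma measurable_hold_own: "hold y \<in> borel_measurable (own_alg (Inr None))"
  using measurable_exp_own[of None] unfolding hold_def[abs_def] exp_family_def by simp

lemma measurable_mark [measurable]: "mark m \<in> borel_measurable M"
  using measurable_from_subalg[OF subalgebra_own_alg measurable_mark_own] by (cases m) simp

lemma measurable_jump [measurable]: "jump m \<in> borel_measurable M"
  using measurable_from_subalg[OF subalgebra_own_alg measurable_jump_own] by (cases m) simp

lemma measurable_hold [measurable]: "hold y \<in> borel_measurable M"
  using measurable_from_subalg[OF subalgebra_own_alg measurable_hold_own] by simp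

section \<open>Integration along the marks of one state\<close>

lemma prob_count:
  assumes "0 < s"
  shows "prob {\<omega>\<in>space M. count_marks (\<sigma> x) s \<omega> \<in> A} = measure_pmf.prob (poisson_pmf (lam x * s)) A"
proof -
  have c0: "count_marks (\<sigma> x) 0 \<omega> = 0" if "\<omega> \<in> space M" for \<omega>
    using mark_le_iff[OF that, of x 0 0] mark_pos[OF that, of "(x, 0)"] by simp
  have [measurable]: "count_marks (\<sigma> x) s \<in> measurable M (count_space UNIV)" 
      "count_marks (\<sigma> x) 0 \<in> measurable M (count_space UNIV)"
    using assms by (auto intro!: measurable_from_subalg[OF subalgebra_own_alg measurable_count_own])
  have D: "distr M (count_space UNIV) (\<lambda>\<omega>. count_marks (\<sigma> x) s \<omega> - count_marks (\<sigma> x) 0 \<omega>)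
      = measure_pmf (poisson_pmf (lam x * s))"
    using conjunct1[OF conjunct2[OF poisson[of x, unfolded poisson_process_def]], rule_format, of 0 s] assms
    by simp
  have "prob {\<omega>\<in>space M. count_marks (\<sigma> x) s \<omega> \<in> A} = measure (distr M (count_space UNIV) (\<lambda>\<omega>. count_marks (\<sigma> x) s \<omega> - count_marks (\<sigma> x) 0 \<omega>)) A"
    by (subst measure_distr) (auto intro!: arg_cong[where f=prob] simp: c0)
  then show ?thesis unfolding D .
qed

text \<open>The mark number \<open>i\<close> comes after \<open>a\<close> iff at most \<open>i\<close> marks have been counted up to \<open>a\<close>, so its
distribution function is read off from the Poisson law of one count.\<close>

lemma mark_erlang: "distributed M lborel (mark (x, i)) (erlang_density i (lam x))"
proof (rule erlang_distributedI)
  fix a :: real assume "0 \<le> a"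
  show "emeasure M {\<omega> \<in> space M. mark (x, i) \<omega> \<le> a} = ennreal (erlang_CDF i (lam x) a)"
  proof (cases "a = 0")
    case True
    then have "{\<omega> \<in> space M. mark (x, i) \<omega> \<le> a} = {}"
      by (auto dest: mark_pos[of _ "(x, i)"])
    then show ?thesis unfolding \<open>{\<omega> \<in> space M. mark (x, i) \<omega> \<le> a} = {}\<close> using True by (simp add: erlang_CDF_at0)
  next
    case False
    then have a: "0 < a" using \<open>0 \<le> a\<close> by simp
    have [simp]: "0 < lam x * a" using a lam_pos by simp
    have "{\<omega> \<in> space M. mark (x, i) \<omega> \<le> a} = {\<omega> \<in> space M. count_marks (\<sigma> x) a \<omega> \<in> - {..i}}"
      using mark_le_iff by auto
    then have "prob {\<omega> \<in> space M. mark (x, i) \<omega> \<le> a} = measure_pmf.prob (poisson_pmf (lam x * a)) (- {..i})"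
      by (simp only: prob_count[OF a])
    also have "\<dots> = 1 - (\<Sum>k\<le>i. pmf (poisson_pmf (lam x * a)) k)"
      using measure_pmf.prob_compl[of "{..i}" "poisson_pmf (lam x * a)"]
      by (simp add: measure_measure_pmf_finite Compl_eq_Diff_UNIV)
    also have "\<dots> = erlang_CDF i (lam x) a"
      using a by (simp add: erlang_CDF_def)
    finally show ?thesis by (simp add: emeasure_eq_measure)
  qed
qed (use lam_pos in simp_all)

lemma T_exponential:
  "distributed M lborel (T x (Suc i)) (exponential_density 1)"
  "distributed M lborel T0 (exponential_density 1)"
  using inputs unfolding k_process_inputs_def
  by (force simp: exp_index_def exp_family_def)+

lemma countable_marks: "countable (UNIV :: ('s \<times> nat) set)"
  using countable_states by (subst UNIV_Times_UNIV[symmetric]) (intro countable_SIGMA, auto)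

lemma measurable_pair_rest:
  assumes "case_prod G \<in> borel_measurable (borel \<Otimes>\<^sub>M rest_alg k)"
  shows "case_prod G \<in> borel_measurable (borel \<Otimes>\<^sub>M M)"
proof -
  have [measurable]: "(\<lambda>\<omega>. \<omega>) \<in> measurable M (rest_alg k)"
    using subalgebra_rest_alg[of k] by (auto simp: measurable_def subalgebra_def)
  have "(\<lambda>p. (fst p, snd p)) \<in> measurable (borel \<Otimes>\<^sub>M M) (borel \<Otimes>\<^sub>M rest_alg k)"
    by measurable
  from measurable_compose[OF this assms] show ?thesis by simp
qed

lemma own_rest_fubini:
  fixes X :: "'w \<Rightarrow> real"
  assumes "k \<in> input_index" "X \<in> borel_measurable (own_alg k)"
    and G: "case_prod G \<in> borel_measurable (borel \<Otimes>\<^sub>M rest_alg k)"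
  shows "(\<integral>\<^sup>+\<omega>. G (X \<omega>) \<omega> \<partial>M) = (\<integral>\<^sup>+\<omega>'. \<integral>\<^sup>+\<omega>. G (X \<omega>') \<omega> \<partial>M \<partial>M)"
  using indep_subalgebras_fubini[OF indep_own_rest[OF assms(1)] subalgebra_own_alg[OF assms(1)]
      subalgebra_rest_alg assms(2) G] by simp

text \<open>The same with the other order of integration: first over the single input, with the rest fixed.\<close>

lemma own_rest_fubini':
  fixes X :: "'w \<Rightarrow> real"
  assumes "k \<in> input_index" "X \<in> borel_measurable (own_alg k)"
    and G: "case_prod G \<in> borel_measurable (borel \<Otimes>\<^sub>M rest_alg k)"
  shows "(\<integral>\<^sup>+\<omega>. G (X \<omega>) \<omega> \<partial>M) = (\<integral>\<^sup>+\<omega>. \<integral>\<^sup>+\<omega>'. G (X \<omega>') \<omega> \<partial>M \<partial>M)"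
proof -
  note measurable_pair_rest[OF G, measurable]
  have [measurable]: "X \<in> borel_measurable M"
    using measurable_from_subalg[OF subalgebra_own_alg[OF assms(1)] assms(2)] .
  interpret P: pair_sigma_finite M M by unfold_locales
  show ?thesis
    unfolding own_rest_fubini[OF assms]
    by (rule P.Fubini') measurable
qed

text \<open>Integration over a mark of \<open>x\<close>, for a functional of the position of the mark that otherwise depends only on inputs
other than the marks of \<open>x\<close>.\<close>

lemma mark_fubini:
  assumes G: "case_prod G \<in> borel_measurable (borel \<Otimes>\<^sub>M rest_alg (Inl x))"
  shows "(\<integral>\<^sup>+\<omega>. G (mark (x, i) \<omega>) \<omega> \<partial>M)
    = (\<integral>\<^sup>+s. ennreal (erlang_density i (lam x) s) * (\<integral>\<^sup>+\<omega>. G s \<omega> \<partial>M) \<partial>lborel)"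
proof -
  note measurable_pair_rest[OF G, measurable]
  have "(\<lambda>s. \<integral>\<^sup>+\<omega>. G s \<omega> \<partial>M) \<in> borel_measurable lborel" by measurable
  from distributed_nn_integral[OF mark_erlang this, of i x] show ?thesis
    using own_rest_fubini[OF Inl_index measurable_mark_own G] by simp
qed

lemma measurable_mark_rest: "k \<noteq> Inl (fst m) \<Longrightarrow> mark m \<in> borel_measurable (rest_alg k)"
  using measurable_rest_alg[OF measurable_mark_own Inl_index] by (cases m) auto

lemma measurable_jump_rest:
  "k \<noteq> Inr (Some (fst m, Suc (snd m))) \<Longrightarrow> jump m \<in> borel_measurable (rest_alg k)"
  using measurable_rest_alg[OF measurable_jump_own Inr_index(2)] by (cases m) auto

lemma measurable_hold_rest: "k \<noteq> Inr None \<Longrightarrow> hold y \<in> borel_measurable (rest_alg k)"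
  using measurable_rest_alg[OF measurable_hold_own Inr_index(1)] by auto

section \<open>Almost sure properties of the clock\<close>

text \<open>Marks of one state increase strictly. For marks of different states, which are independent, one of them has a density and
therefore almost surely avoids the value of the other.\<close>

lemma AE_marks_distinct: "AE \<omega> in M. inj (\<lambda>m. mark m \<omega>)"
proof -
  have "AE \<omega> in M. mark m \<omega> \<noteq> mark n \<omega>" if "m \<noteq> n" for m n
  proof (cases "fst m = fst n")
    case True
    then have "snd m \<noteq> snd n" using that by (simp add: prod_eq_iff)
    then show ?thesis
      using mark_less_iff[of _ "fst m" "snd m" "snd n"] mark_less_iff[of _ "fst m" "snd n" "snd m"] True
      by (intro AE_I2) (cases m; cases n; fastforce simp: neq_iff)
  next
    case False
    let ?G = "\<lambda>s \<omega>. indicator {\<omega>'. mark n \<omega>' = s} \<omega> :: ennreal"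
    have [measurable]: "mark n \<in> borel_measurable (rest_alg (Inl (fst m)))"
      using False by (intro measurable_mark_rest) auto
    have "case_prod ?G = (\<lambda>p. if mark n (snd p) = fst p then 1 else 0)"
      by (auto simp: fun_eq_iff)
    also have "\<dots> \<in> borel_measurable (borel \<Otimes>\<^sub>M rest_alg (Inl (fst m)))" by measurable
    finally have G: "case_prod ?G \<in> borel_measurable (borel \<Otimes>\<^sub>M rest_alg (Inl (fst m)))" .
    have "(\<integral>\<^sup>+\<omega>. ?G (mark m \<omega>) \<omega> \<partial>M) = (\<integral>\<^sup>+\<omega>. \<integral>\<^sup>+\<omega>'. ?G (mark m \<omega>') \<omega> \<partial>M \<partial>M)"
      using own_rest_fubini'[OF Inl_index measurable_mark_own[of "fst m" "snd m"] G] by simp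
    also have "\<dots> = (\<integral>\<^sup>+\<omega>. 0 \<partial>M)"
    proof (intro nn_integral_cong)
      fix \<omega>
      have "(\<integral>\<^sup>+\<omega>'. ?G (mark m \<omega>') \<omega> \<partial>M) = (\<integral>\<^sup>+\<omega>'. indicator {mark n \<omega>} (mark m \<omega>') \<partial>M)"
        by (intro nn_integral_cong) (auto simp: indicator_def)
      also have "\<dots> = (\<integral>\<^sup>+s. ennreal (erlang_density (snd m) (lam (fst m)) s) * indicator {mark n \<omega>} s \<partial>lborel)"
        using distributed_nn_integral[OF mark_erlang[of "fst m" "snd m"], of "indicator {mark n \<omega>}"] by simp
      also have "\<dots> = (\<integral>\<^sup>+s. 0 \<partial>(lborel :: real measure))"
      proof (rule nn_integral_cong_AE)
        show "AE s in lborel. ennreal (erlang_density (snd m) (lam (fst m)) s) * indicator {mark n \<omega>} s = 0"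
          using AE_lborel_singleton[of "mark n \<omega>"] by eventually_elim simp
      qed
      finally show "(\<integral>\<^sup>+\<omega>'. ?G (mark m \<omega>') \<omega> \<partial>M) = 0" by simp
    qed
    finally have "(\<integral>\<^sup>+\<omega>. (if mark n \<omega> = mark m \<omega> then 1 else 0) \<partial>M) = (0::ennreal)"
      by (simp add: indicator_def of_bool_def)
    then have "AE \<omega> in M. (if mark n \<omega> = mark m \<omega> then 1 else 0) = (0::ennreal)"
      by (subst (asm) nn_integral_0_iff_AE) measurable
    then show ?thesis by eventually_elim (auto split: if_splits)
  qed
  then have "AE \<omega> in M. \<forall>m\<in>UNIV. \<forall>n\<in>UNIV. m \<noteq> n \<longrightarrow> mark m \<omega> \<noteq> mark n \<omega>"
    by (intro AE_ball_countable[OF countable_marks, THEN iffD2] ballI AE_impI)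
  then show ?thesis by eventually_elim (auto simp: inj_def)
qed

lemma exp_jump: "(\<integral>\<^sup>+\<omega>. jump (x, i) \<omega> \<partial>M) = ennreal (\<gamma> x)"
proof -
  have "(\<integral>\<^sup>+\<omega>. jump (x, i) \<omega> \<partial>M) = (\<integral>\<^sup>+s. ennreal (exponential_density 1 s) * ennreal (\<gamma> x * s) \<partial>lborel)"
    unfolding jump_def using distributed_nn_integral[OF T_exponential(1), of "\<lambda>s. ennreal (\<gamma> x * s)"] by simp
  also have "\<dots> = (\<integral>\<^sup>+s. ennreal (\<gamma> x) * ennreal (erlang_density 0 1 s * s ^ 1) \<partial>lborel)"
    using \<gamma>_pos[of x]
    by (intro nn_integral_cong) (auto simp: erlang_density_def ennreal_mult'[symmetric] ac_simps)
  also have "\<dots> = ennreal (\<gamma> x)"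
    by (subst nn_integral_cmult) (simp, subst nn_integral_erlang_ith_moment, simp_all)
  finally show ?thesis .
qed

lemma rates_finite: "(\<integral>\<^sup>+x. ennreal (lam x * \<gamma> x) \<partial>count_space UNIV) = ennreal (\<Sum>\<^sub>\<infinity>x\<in>UNIV. lam x * \<gamma> x)"
  using has_sum_iff_nn_integral[OF countable_states infinite_states, of "\<lambda>x. lam x * \<gamma> x"]
    has_sum_infsum[OF summable_rates] \<gamma>_pos lam_pos
  by (simp add: infsum_nonneg less_imp_le)

text \<open>The expected sum of the jumps up to time \<open>r\<close> is \<open>r\<close> times the sum of \<open>lam x * \<gamma> x\<close>.\<close>

lemma expected_jumps_finite:
  assumes "0 \<le> r"
  shows "(\<integral>\<^sup>+\<omega>. \<integral>\<^sup>+m. (if mark m \<omega> \<le> r then jump m \<omega> else 0) \<partial>count_space UNIV \<partial>M) < \<infinity>"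
proof -
  have one: "(\<integral>\<^sup>+\<omega>. (if mark (x, i) \<omega> \<le> r then jump (x, i) \<omega> else 0) \<partial>M)
    = (\<integral>\<^sup>+s. ennreal (erlang_density i (lam x) s) * (ennreal (\<gamma> x) * indicator {..r} s) \<partial>lborel)" for x i
  proof -
    let ?G = "\<lambda>s \<omega>. if s \<le> r then jump (x, i) \<omega> else 0"
    have [measurable]: "jump (x, i) \<in> borel_measurable (rest_alg (Inl x))"
      by (rule measurable_jump_rest) simp
    have "case_prod ?G \<in> borel_measurable (borel \<Otimes>\<^sub>M rest_alg (Inl x))"
      by measurable
    from mark_fubini[OF this, of i] show ?thesis
      by (auto intro!: nn_integral_cong simp: indicator_def exp_jump)
  qed
  have "(\<integral>\<^sup>+\<omega>. \<integral>\<^sup>+m. (if mark m \<omega> \<le> r then jump m \<omega> else 0) \<partial>count_space UNIV \<partial>M)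
     = (\<integral>\<^sup>+m. \<integral>\<^sup>+\<omega>. (if mark m \<omega> \<le> r then jump m \<omega> else 0) \<partial>M \<partial>count_space UNIV)"
    using countable_marks by (intro nn_integral_count_space_nn_integral) measurable
  also have "\<dots> = (\<integral>\<^sup>+x. \<integral>\<^sup>+i. \<integral>\<^sup>+\<omega>. (if mark (x, i) \<omega> \<le> r then jump (x, i) \<omega> else 0) \<partial>M \<partial>count_space UNIV \<partial>count_space UNIV)"
    by (rule nn_integral_fst_count_space[symmetric])
  also have "\<dots> = (\<integral>\<^sup>+x. ennreal (lam x * \<gamma> x) * ennreal r \<partial>count_space UNIV)"
  proof (intro nn_integral_cong)
    fix x
    have "(\<integral>\<^sup>+i. \<integral>\<^sup>+\<omega>. (if mark (x, i) \<omega> \<le> r then jump (x, i) \<omega> else 0) \<partial>M \<partial>count_space UNIV)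
      = (\<integral>\<^sup>+s. \<integral>\<^sup>+i. ennreal (erlang_density i (lam x) s) * (ennreal (\<gamma> x) * indicator {..r} s) \<partial>count_space UNIV \<partial>lborel)"
      unfolding one by (rule nn_integral_count_space_nn_integral[symmetric]) auto
    also have "\<dots> = (\<integral>\<^sup>+s. ennreal (lam x * \<gamma> x) * indicator {0..r} s \<partial>lborel)"
    proof (intro nn_integral_cong_AE eventually_mono[OF AE_lborel_singleton[of 0]])
      fix s :: real assume "s \<noteq> 0"
      show "(\<integral>\<^sup>+i. ennreal (erlang_density i (lam x) s) * (ennreal (\<gamma> x) * indicator {..r} s) \<partial>count_space UNIV)
        = ennreal (lam x * \<gamma> x) * indicator {0..r} s"
      proof (cases "0 < s")
        case True
        then show ?thesis
          using erlang_density_total[OF lam_pos True, of x] lam_pos[of x] \<gamma>_pos[of x]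
          by (auto simp: nn_integral_multc indicator_def ennreal_mult)
      qed (use \<open>s \<noteq> 0\<close> in \<open>simp add: erlang_density_def\<close>)
    qed
    also have "\<dots> = ennreal (lam x * \<gamma> x) * ennreal r"
      using assms by (simp add: nn_integral_cmult_indicator)
    finally show "(\<integral>\<^sup>+i. \<integral>\<^sup>+\<omega>. (if mark (x, i) \<omega> \<le> r then jump (x, i) \<omega> else 0) \<partial>M \<partial>count_space UNIV)
      = ennreal (lam x * \<gamma> x) * ennreal r" .
  qed
  also have "\<dots> < \<infinity>"
    by (simp add: nn_integral_multc rates_finite ennreal_mult_less_top)
  finally show ?thesis .
qed

lemma AE_clock_finite: "AE \<omega> in M. \<forall>r y. \<Gamma> y r \<omega> < \<infinity>"
proof -
  let ?J = "\<lambda>r \<omega>. \<integral>\<^sup>+m. (if mark m \<omega> \<le> r then jump m \<omega> else 0) \<partial>count_space UNIV"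
  have "AE \<omega> in M. ?J (real n) \<omega> < \<infinity>" for n
  proof -
    have "?J (real n) \<in> borel_measurable M"
      by (rule borel_measurable_nn_integral_count_space[OF countable_marks]) measurable
    then have "AE \<omega> in M. ?J (real n) \<omega> \<noteq> \<infinity>"
      using expected_jumps_finite[of "real n"] by (intro nn_integral_PInf_AE) auto
    then show ?thesis by (simp add: top.not_eq_extremum)
  qed
  then have "AE \<omega> in M. \<forall>n. ?J (real n) \<omega> < \<infinity>" by (simp add: AE_all_countable)
  then show ?thesis
  proof eventually_elim
    case (elim \<omega>)
    show ?case
    proof (intro allI)
      fix r y
      obtain n where "r \<le> real n" using real_arch_simple by blast
      then have "?J r \<omega> \<le> ?J (real n) \<omega>" by (intro nn_integral_mono) auto
      then have "?J r \<omega> < \<infinity>" using elim by (meson le_less_trans)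
      then show "\<Gamma> y r \<omega> < \<infinity>"
        by (simp add: \<Gamma>_def jump_clock_def hold_def)
    qed
  qed
qed

section \<open>The probability of being in a sojourn\<close>

text \<open>The clock just before time \<open>s\<close>, if \<open>s\<close> were the position of the mark \<open>(x, i)\<close>: exactly the marks
\<open>(x, 0), ..., (x, i - 1)\<close> of \<open>x\<close> have occurred. The positions of the marks of \<open>x\<close> do not enter, nor does the
length of the jump at \<open>(x, i)\<close>; this makes it independent of both. For the other states marks at \<open>s\<close> itself are
counted, which agrees with the left limit almost surely, since no two marks coincide.\<close>

definition pre_mark :: "'s \<Rightarrow> 's option \<Rightarrow> nat \<Rightarrow> real \<Rightarrow> 'w \<Rightarrow> ennreal" where
  "pre_mark x y i s \<omega> = hold y \<omega>
     + (\<integral>\<^sup>+m. (if if fst m = x then snd m < i else mark m \<omega> \<le> s then jump m \<omega> else 0) \<partial>count_space UNIV)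
     + ennreal (c * s)"

lemma pre_mark_eq_clock:
  assumes "\<omega> \<in> space M" "count_marks (\<sigma> x) s \<omega> = i"
  shows "pre_mark x y i s \<omega> = \<Gamma> y s \<omega>"
proof -
  have "(if fst m = x then snd m < i else mark m \<omega> \<le> s) \<longleftrightarrow> mark m \<omega> \<le> s" for m
    using mark_le_iff[OF assms(1), of x "snd m" s] assms(2) by (cases m) auto
  then show ?thesis by (simp add: pre_mark_def \<Gamma>_def jump_clock_def)
qed

lemma clock_left_at_mark:
  assumes "\<omega> \<in> space M" "inj (\<lambda>m. mark m \<omega>)"
  shows "\<Gamma>_left y (mark (x, i) \<omega>) \<omega> = pre_mark x y i (mark (x, i) \<omega>) \<omega>"
proof -
  have "(if fst m = x then snd m < i else mark m \<omega> \<le> mark (x, i) \<omega>) \<longleftrightarrow> mark m \<omega> < mark (x, i) \<omega>" for m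
    using mark_less_iff[OF assms(1), of x "snd m" i] injD[OF assms(2), of m "(x, i)"]
    by (cases m) (auto simp: order.order_iff_strict)
  then show ?thesis by (simp add: pre_mark_def \<Gamma>_left_def jump_clock_left_def)
qed

lemma clock_at_mark:
  "inj (\<lambda>m. mark m \<omega>) \<Longrightarrow> \<Gamma> y (mark m \<omega>) \<omega> = \<Gamma>_left y (mark m \<omega>) \<omega> + jump m \<omega>"
  unfolding \<Gamma>_def \<Gamma>_left_def by (rule jump_clock_at_mark)

lemma measurable_clock [measurable]:
  "(\<lambda>p. \<Gamma> y (fst p) (snd p)) \<in> borel_measurable (borel \<Otimes>\<^sub>M M)"
  unfolding \<Gamma>_def jump_clock_def
  by (intro borel_measurable_add borel_measurable_nn_integral_count_space[OF countable_marks]) measurable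

lemma measurable_clock_at [measurable]: "\<Gamma> y s \<in> borel_measurable M"
  using measurable_Pair2[OF measurable_clock[of y], of s] by simp

lemma measurable_clock_rest:
  "\<Gamma> None s \<in> borel_measurable (rest_alg (Inr None))"
proof -
  have [measurable]: "mark m \<in> borel_measurable (rest_alg (Inr None))" 
    "jump m \<in> borel_measurable (rest_alg (Inr None))" for m
    by (auto intro: measurable_mark_rest measurable_jump_rest)
  have "hold None = (\<lambda>\<omega>. 0)" by (simp add: hold_def fun_eq_iff ext_rate_def)
  then show ?thesis
    unfolding \<Gamma>_def[abs_def] jump_clock_def
    by (simp, intro borel_measurable_add borel_measurable_nn_integral_count_space[OF countable_marks]) measurable
qed

lemma measurable_pre_mark_rest:
  "(\<lambda>p. pre_mark x y i (fst p) (snd p)) \<in> borel_measurable (borel \<Otimes>\<^sub>M rest_alg (Inl x))"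
proof -
  let ?R = "rest_alg (Inl x)"
  have [measurable]: "jump m \<in> borel_measurable ?R" "hold y \<in> borel_measurable ?R" for m
    by (auto intro: measurable_hold_rest measurable_jump_rest)
  have 1: "(\<lambda>p. if if fst m = x then snd m < i else mark m (snd p) \<le> fst p then jump m (snd p) else 0)
      \<in> borel_measurable (borel \<Otimes>\<^sub>M ?R)" for m
  proof (cases "fst m = x")
    case False
    then have [measurable]: "mark m \<in> borel_measurable ?R" by (intro measurable_mark_rest) auto
    show ?thesis using False by simp
  qed simp
  show ?thesis
    unfolding pre_mark_def
    by (intro borel_measurable_add borel_measurable_nn_integral_count_space[OF countable_marks] 1) measurable
qed

lemma measurable_pre_mark_rest':
  "pre_mark x y i s \<in> borel_measurable (rest_alg (Inr (Some (x, Suc i))))"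
proof -
  let ?R = "rest_alg (Inr (Some (x, Suc i)))"
  have [measurable]: "mark m \<in> borel_measurable ?R" "hold y \<in> borel_measurable ?R" for m
    by (auto intro: measurable_mark_rest measurable_hold_rest)
  have 1: "(\<lambda>\<omega>. if if fst m = x then snd m < i else mark m \<omega> \<le> s then jump m \<omega> else 0)
      \<in> borel_measurable ?R" for m
  proof (cases "m = (x, i)")
    case False
    then have [measurable]: "jump m \<in> borel_measurable ?R" by (intro measurable_jump_rest) (auto simp: prod_eq_iff)
    show ?thesis by measurable
  qed simp
  show ?thesis
    unfolding pre_mark_def[abs_def]
    by (intro borel_measurable_add borel_measurable_nn_integral_count_space[OF countable_marks] 1) measurable
qed

text \<open>The probability that an interval that starts at \<open>v\<close> and has an exponential length of mean \<open>\<gamma> x\<close> contains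
\<open>t\<close>.\<close>

definition decay :: "'s \<Rightarrow> real \<Rightarrow> ennreal \<Rightarrow> ennreal" where
  "decay x t v = (if v \<le> ennreal t then ennreal (exp (- ((t - enn2real v) / \<gamma> x))) else 0)"

lemma measurable_decay [measurable]: "decay x t \<in> borel_measurable borel"
  unfolding decay_def[abs_def] by measurable

lemma prob_straddle:
  assumes "0 \<le> t" "X \<in> borel_measurable M" and X: "distributed M lborel X (exponential_density 1)"
  shows "(\<integral>\<^sup>+\<omega>. indicator {b..<b + ennreal (\<gamma> x * X \<omega>)} (ennreal t) \<partial>M) = decay x t b"
proof (cases "b \<le> ennreal t")
  case True
  then obtain b' where b': "b = ennreal b'" "0 \<le> b'" "b' \<le> t"
    using assms(1) by (cases b) (auto simp: top_unique)
  have iff: "ennreal t < b + ennreal (\<gamma> x * X \<omega>) \<longleftrightarrow> (t - b') / \<gamma> x < X \<omega>" for \<omega>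
  proof (cases "0 \<le> X \<omega>")
    case True
    then have "b + ennreal (\<gamma> x * X \<omega>) = ennreal (b' + \<gamma> x * X \<omega>)"
      using b' \<gamma>_pos[of x] by (simp add: ennreal_plus)
    then have "ennreal t < b + ennreal (\<gamma> x * X \<omega>) \<longleftrightarrow> t < b' + \<gamma> x * X \<omega>"
      using assms(1) by (simp add: ennreal_less_iff)
    then show ?thesis using \<gamma>_pos[of x] by (simp add: field_simps)
  next
    case False
    then have "ennreal (\<gamma> x * X \<omega>) = 0" using \<gamma>_pos[of x] by (simp add: ennreal_eq_0_iff mult_le_0_iff)
    moreover have "0 \<le> (t - b') / \<gamma> x" using b' \<gamma>_pos[of x] by simp
    ultimately show ?thesis using False b' assms(1) by (auto simp: ennreal_less_iff)
  qed
  have "(\<integral>\<^sup>+\<omega>. indicator {b..<b + ennreal (\<gamma> x * X \<omega>)} (ennreal t) \<partial>M)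
      = (\<integral>\<^sup>+\<omega>. indicator {\<omega> \<in> space M. (t - b') / \<gamma> x < X \<omega>} \<omega> \<partial>M)"
    using True by (intro nn_integral_cong) (auto simp: indicator_def iff)
  also have "\<dots> = emeasure M {\<omega> \<in> space M. (t - b') / \<gamma> x < X \<omega>}"
    using assms(2) by (intro nn_integral_indicator) simp
  also have "\<dots> = ennreal (exp (- ((t - b') / \<gamma> x)))"
    using exponential_distributedD_gt[OF X, of "(t - b') / \<gamma> x"] b' \<gamma>_pos[of x]
    by (simp add: emeasure_eq_measure)
  also have "\<dots> = decay x t b"
    using True b' by (simp add: decay_def)
  finally show ?thesis .
qed (simp add: decay_def)

text \<open>The Erlang density contains the probability that \<open>i\<close> marks of \<open>x\<close> precede \<open>s\<close>. By independence this
probability can be taken inside the expectation as an indicator, and on that event \<open>pre_mark\<close> is the clock itself.\<close>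

lemma expected_pre_mark:
  assumes "0 < s"
  shows "ennreal (erlang_density i (lam x) s) * (\<integral>\<^sup>+\<omega>. decay x t (pre_mark x y i s \<omega>) \<partial>M)
    = ennreal (lam x) * (\<integral>\<^sup>+\<omega>. indicator {i} (count_marks (\<sigma> x) s \<omega>) * decay x t (\<Gamma> y s \<omega>) \<partial>M)"
proof -
  let ?X = "\<lambda>\<omega>. real (count_marks (\<sigma> x) s \<omega>)"
  let ?G = "\<lambda>n \<omega>. indicator {real i} n * decay x t (pre_mark x y i s \<omega>)"
  have cm: "count_marks (\<sigma> x) s \<in> measurable (own_alg (Inl x)) (count_space UNIV)"
    using assms by (intro measurable_count_own) simp
  then have X: "?X \<in> borel_measurable (own_alg (Inl x))" by measurable
  have [measurable]: "pre_mark x y i s \<in> borel_measurable (rest_alg (Inl x))"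
    using measurable_Pair2[OF measurable_pre_mark_rest[of x y i], of s] by simp
  have G: "case_prod ?G \<in> borel_measurable (borel \<Otimes>\<^sub>M rest_alg (Inl x))"
    by measurable
  have [measurable]: "count_marks (\<sigma> x) s \<in> measurable M (count_space UNIV)"
    "pre_mark x y i s \<in> borel_measurable M"
    using measurable_from_subalg[OF subalgebra_own_alg cm]
      measurable_from_subalg[OF subalgebra_rest_alg \<open>pre_mark x y i s \<in> borel_measurable (rest_alg (Inl x))\<close>]
    by simp_all
  have "(\<integral>\<^sup>+\<omega>. indicator {i} (count_marks (\<sigma> x) s \<omega>) * decay x t (\<Gamma> y s \<omega>) \<partial>M)
      = (\<integral>\<^sup>+\<omega>. ?G (?X \<omega>) \<omega> \<partial>M)"
    using pre_mark_eq_clock by (intro nn_integral_cong) (auto simp: indicator_def)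
  also have "\<dots> = (\<integral>\<^sup>+\<omega>'. \<integral>\<^sup>+\<omega>. ?G (?X \<omega>') \<omega> \<partial>M \<partial>M)"
    by (rule own_rest_fubini[OF Inl_index X G])
  also have "\<dots> = (\<integral>\<^sup>+\<omega>'. indicator {\<omega>\<in>space M. count_marks (\<sigma> x) s \<omega> \<in> {i}} \<omega>' 
      * (\<integral>\<^sup>+\<omega>. decay x t (pre_mark x y i s \<omega>) \<partial>M) \<partial>M)"
    by (intro nn_integral_cong) (auto simp: nn_integral_cmult indicator_def)
  also have "\<dots> = ennreal (prob {\<omega>\<in>space M. count_marks (\<sigma> x) s \<omega> \<in> {i}}) * (\<integral>\<^sup>+\<omega>. decay x t (pre_mark x y i s \<omega>) \<partial>M)"
    by (simp add: nn_integral_multc emeasure_eq_measure)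
  also have "prob {\<omega>\<in>space M. count_marks (\<sigma> x) s \<omega> \<in> {i}} = pmf (poisson_pmf (lam x * s)) i"
    by (simp only: prob_count[OF assms]) (simp add: measure_pmf_single)
  finally show ?thesis
    using lam_pos[of x] assms
    by (simp add: erlang_density_eq_poisson ennreal_mult ac_simps del: pmf_poisson)
qed

text \<open>Each time \<open>s\<close> contributes the probability that a sojourn of \<open>x\<close> that begins at the clock value
\<open>\<Gamma> y s\<close> covers \<open>t\<close>.\<close>

definition discounted_occupation :: "'s option \<Rightarrow> 's \<Rightarrow> real \<Rightarrow> ennreal" where
  "discounted_occupation y x t = (\<integral>\<^sup>+s. indicator {0..} s * (\<integral>\<^sup>+\<omega>. decay x t (\<Gamma> y s \<omega>) \<partial>M) \<partial>lborel)"

abbreviation sojourn_interval :: "'s option \<Rightarrow> 's \<times> nat \<Rightarrow> 'w \<Rightarrow> ennreal set" where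
  "sojourn_interval y m \<omega> \<equiv> {\<Gamma>_left y (mark m \<omega>) \<omega> ..< \<Gamma> y (mark m \<omega>) \<omega>}"

text \<open>First the position of the mark is integrated out against its Erlang density, then the length of the jump.\<close>

lemma mark_sojourn_prob:
  assumes t: "0 \<le> t"
  shows "(\<integral>\<^sup>+\<omega>. indicator (sojourn_interval y (x, i) \<omega>) (ennreal t) \<partial>M)
    = (\<integral>\<^sup>+s. ennreal (erlang_density i (lam x) s) * (\<integral>\<^sup>+\<omega>. decay x t (pre_mark x y i s \<omega>) \<partial>M) \<partial>lborel)"
proof -
  let ?G = "\<lambda>s \<omega>. indicator {pre_mark x y i s \<omega>..<pre_mark x y i s \<omega> + jump (x, i) \<omega>} (ennreal t) :: ennreal"
  note [measurable] = measurable_pre_mark_rest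
  have [measurable]: "jump (x, i) \<in> borel_measurable (rest_alg (Inl x))"
    by (rule measurable_jump_rest) simp
  have "case_prod ?G = (\<lambda>p. if pre_mark x y i (fst p) (snd p) \<le> ennreal t
      \<and> ennreal t < pre_mark x y i (fst p) (snd p) + jump (x, i) (snd p) then 1 else 0)"
    by (auto simp: fun_eq_iff indicator_def)
  also have "\<dots> \<in> borel_measurable (borel \<Otimes>\<^sub>M rest_alg (Inl x))"
    by measurable
  finally have G: "case_prod ?G \<in> borel_measurable (borel \<Otimes>\<^sub>M rest_alg (Inl x))" .
  have inner: "(\<integral>\<^sup>+\<omega>. ?G s \<omega> \<partial>M) = (\<integral>\<^sup>+\<omega>. decay x t (pre_mark x y i s \<omega>) \<partial>M)" for s
  proof -
    let ?R = "rest_alg (Inr (Some (x, Suc i)))"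
    let ?H = "\<lambda>u \<omega>. indicator {pre_mark x y i s \<omega>..<pre_mark x y i s \<omega> + ennreal (\<gamma> x * u)} (ennreal t) :: ennreal"
    note [measurable] = measurable_pre_mark_rest'
    have "case_prod ?H = (\<lambda>p. if pre_mark x y i s (snd p) \<le> ennreal t
        \<and> ennreal t < pre_mark x y i s (snd p) + ennreal (\<gamma> x * fst p) then 1 else 0)"
      by (auto simp: fun_eq_iff indicator_def)
    also have "\<dots> \<in> borel_measurable (borel \<Otimes>\<^sub>M ?R)"
      by measurable
    finally have H: "case_prod ?H \<in> borel_measurable (borel \<Otimes>\<^sub>M ?R)" .
    have X: "T x (Suc i) \<in> borel_measurable (own_alg (Inr (Some (x, Suc i))))"
      using measurable_exp_own[of "Some (x, Suc i)"] by (simp add: exp_family_def)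
    have "(\<integral>\<^sup>+\<omega>. ?G s \<omega> \<partial>M) = (\<integral>\<^sup>+\<omega>. ?H (T x (Suc i) \<omega>) \<omega> \<partial>M)"
      by (simp add: jump_def)
    also have "\<dots> = (\<integral>\<^sup>+\<omega>. \<integral>\<^sup>+\<omega>'. ?H (T x (Suc i) \<omega>') \<omega> \<partial>M \<partial>M)"
      by (rule own_rest_fubini'[OF Inr_index(2) X H])
    also have "\<dots> = (\<integral>\<^sup>+\<omega>. decay x t (pre_mark x y i s \<omega>) \<partial>M)"
      using prob_straddle[OF t measurable_from_subalg[OF subalgebra_own_alg[OF Inr_index(2)] X] T_exponential(1)]
      by simp
    finally show ?thesis .
  qed
  have "(\<integral>\<^sup>+\<omega>. indicator (sojourn_interval y (x, i) \<omega>) (ennreal t) \<partial>M) = (\<integral>\<^sup>+\<omega>. ?G (mark (x, i) \<omega>) \<omega> \<partial>M)"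
    using AE_marks_distinct AE_space
    by (intro nn_integral_cong_AE, eventually_elim) (simp add: clock_at_mark clock_left_at_mark)
  also have "\<dots> = (\<integral>\<^sup>+s. ennreal (erlang_density i (lam x) s) * (\<integral>\<^sup>+\<omega>. ?G s \<omega> \<partial>M) \<partial>lborel)"
    by (rule mark_fubini[OF G])
  finally show ?thesis by (simp only: inner)
qed

text \<open>For fixed \<open>s\<close> the indicators that exactly \<open>i\<close> marks precede \<open>s\<close> add up to one, so the sum over the marks
of \<open>x\<close> leaves only the integral over \<open>s\<close>.\<close>

lemma sojourn_prob:
  assumes t: "0 \<le> t"
  shows "(\<integral>\<^sup>+i. \<integral>\<^sup>+\<omega>. indicator (sojourn_interval y (x, i) \<omega>) (ennreal t) \<partial>M \<partial>count_space UNIV)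
    = ennreal (lam x) * discounted_occupation y x t"
proof -
  have pm [measurable]: "(\<lambda>p. pre_mark x y i (fst p) (snd p)) \<in> borel_measurable (borel \<Otimes>\<^sub>M M)" for i
    using measurable_pair_rest[of "pre_mark x y i" "Inl x"] measurable_pre_mark_rest[of x y i]
    by (simp add: split_beta')
  have "(\<integral>\<^sup>+i. \<integral>\<^sup>+\<omega>. indicator (sojourn_interval y (x, i) \<omega>) (ennreal t) \<partial>M \<partial>count_space UNIV)
    = (\<integral>\<^sup>+s. \<integral>\<^sup>+i. ennreal (erlang_density i (lam x) s) * (\<integral>\<^sup>+\<omega>. decay x t (pre_mark x y i s \<omega>) \<partial>M) \<partial>count_space UNIV \<partial>lborel)"
    unfolding mark_sojourn_prob[OF t]
    by (rule nn_integral_count_space_nn_integral[symmetric]) (auto, measurable)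
  also have "\<dots> = (\<integral>\<^sup>+s. ennreal (lam x) * (indicator {0..} s * (\<integral>\<^sup>+\<omega>. decay x t (\<Gamma> y s \<omega>) \<partial>M)) \<partial>lborel)"
  proof (intro nn_integral_cong_AE eventually_mono[OF AE_lborel_singleton[of 0]])
    fix s :: real assume "s \<noteq> 0"
    show "(\<integral>\<^sup>+i. ennreal (erlang_density i (lam x) s) * (\<integral>\<^sup>+\<omega>. decay x t (pre_mark x y i s \<omega>) \<partial>M) \<partial>count_space UNIV)
      = ennreal (lam x) * (indicator {0..} s * (\<integral>\<^sup>+\<omega>. decay x t (\<Gamma> y s \<omega>) \<partial>M))"
    proof (cases "0 < s")
      case True
      have [measurable]: "count_marks (\<sigma> x) s \<in> measurable M (count_space UNIV)"
        using True by (intro measurable_from_subalg[OF subalgebra_own_alg measurable_count_own]) auto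
      have ind [measurable]: "(\<lambda>\<omega>. indicator {i} (count_marks (\<sigma> x) s \<omega>) :: ennreal) \<in> borel_measurable M" for i
        by (rule measurable_compose[OF \<open>count_marks (\<sigma> x) s \<in> measurable M (count_space UNIV)\<close>]) simp
      have "(\<integral>\<^sup>+i. ennreal (erlang_density i (lam x) s) * (\<integral>\<^sup>+\<omega>. decay x t (pre_mark x y i s \<omega>) \<partial>M) \<partial>count_space UNIV)
        = ennreal (lam x) * (\<integral>\<^sup>+i. \<integral>\<^sup>+\<omega>. indicator {i} (count_marks (\<sigma> x) s \<omega>) * decay x t (\<Gamma> y s \<omega>) \<partial>M \<partial>count_space UNIV)"
        unfolding expected_pre_mark[OF True] by (rule nn_integral_cmult) simp
      also have "(\<integral>\<^sup>+i. \<integral>\<^sup>+\<omega>. indicator {i} (count_marks (\<sigma> x) s \<omega>) * decay x t (\<Gamma> y s \<omega>) \<partial>M \<partial>count_space UNIV)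
        = (\<integral>\<^sup>+\<omega>. \<integral>\<^sup>+i. indicator {i} (count_marks (\<sigma> x) s \<omega>) * decay x t (\<Gamma> y s \<omega>) \<partial>count_space UNIV \<partial>M)"
        by (rule nn_integral_count_space_nn_integral[symmetric])
          (auto intro!: borel_measurable_times ind)
      also have "\<dots> = (\<integral>\<^sup>+\<omega>. decay x t (\<Gamma> y s \<omega>) \<partial>M)"
      proof (intro nn_integral_cong)
        fix \<omega>
        have "(\<integral>\<^sup>+i. indicator {i} (count_marks (\<sigma> x) s \<omega>) * decay x t (\<Gamma> y s \<omega>) \<partial>count_space UNIV)
          = (\<integral>\<^sup>+i. decay x t (\<Gamma> y s \<omega>) * indicator {count_marks (\<sigma> x) s \<omega>} i \<partial>count_space UNIV)"
          by (intro nn_integral_cong) (auto simp: indicator_def)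
        then show "(\<integral>\<^sup>+i. indicator {i} (count_marks (\<sigma> x) s \<omega>) * decay x t (\<Gamma> y s \<omega>) \<partial>count_space UNIV)
          = decay x t (\<Gamma> y s \<omega>)"
          by (simp add: nn_integral_cmult_indicator)
      qed
      finally show ?thesis using True by simp
    qed (use \<open>s \<noteq> 0\<close> in \<open>simp add: erlang_density_def\<close>)
  qed
  also have "\<dots> = ennreal (lam x) * discounted_occupation y x t"
    unfolding discounted_occupation_def by (rule nn_integral_cmult) measurable
  finally show ?thesis .
qed

lemma measurable_clock_left [measurable]:
  "(\<lambda>p. \<Gamma>_left y (fst p) (snd p)) \<in> borel_measurable (borel \<Otimes>\<^sub>M M)"
  unfolding \<Gamma>_left_def jump_clock_left_def
  by (intro borel_measurable_add borel_measurable_nn_integral_count_space[OF countable_marks]) measurable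

lemma measurable_clock_mark [measurable]:
  "(\<lambda>\<omega>. \<Gamma> y (mark m \<omega>) \<omega>) \<in> borel_measurable M"
  "(\<lambda>\<omega>. \<Gamma>_left y (mark m \<omega>) \<omega>) \<in> borel_measurable M"
proof -
  have 1: "(\<lambda>\<omega>. (mark m \<omega>, \<omega>)) \<in> measurable M (borel \<Otimes>\<^sub>M M)" by measurable
  show "(\<lambda>\<omega>. \<Gamma> y (mark m \<omega>) \<omega>) \<in> borel_measurable M"
    using measurable_compose[OF 1 measurable_clock[of y]] by simp
  show "(\<lambda>\<omega>. \<Gamma>_left y (mark m \<omega>) \<omega>) \<in> borel_measurable M"
    using measurable_compose[OF 1 measurable_clock_left[of y]] by simp
qed

section \<open>Transition probabilities\<close>

lemma sojourn_eq:
  assumes "\<omega> \<in> space M"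
  shows "sojourn \<gamma> c \<sigma> T0 T y x \<omega> = (\<Union>i. sojourn_interval y (x, i) \<omega>)"
proof -
  have "{1..} = range Suc"
  proof safe
    fix n :: nat assume "1 \<le> n"
    then show "n \<in> range Suc" by (cases n) auto
  qed auto
  then show ?thesis
    using assms by (simp add: sojourn_def clock_eq clock_left_eq mark_def)
qed

text \<open>The interval of an earlier mark ends at the value of the clock there, which is at most the left limit at the later mark,
where the other interval begins.\<close>

lemma sojourn_intervals_disjoint:
  assumes "inj (\<lambda>m. mark m \<omega>)" "u \<in> sojourn_interval y m \<omega>" "u \<in> sojourn_interval y n \<omega>"
  shows "m = n"
proof -
  have False if "u \<in> sojourn_interval y m \<omega>" "u \<in> sojourn_interval y n \<omega>" "mark m \<omega> < mark n \<omega>" for m n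
  proof -
    have "\<Gamma> y (mark m \<omega>) \<omega> \<le> \<Gamma>_left y (mark n \<omega>) \<omega>"
      unfolding \<Gamma>_def \<Gamma>_left_def using c_nonneg that(3) by (rule jump_clock_le_left)
    then have "\<Gamma> y (mark m \<omega>) \<omega> \<le> u" using that(2) by (auto intro: order_trans)
    then show False using that(1) by (auto dest: leD)
  qed
  then have "mark m \<omega> = mark n \<omega>"
    using assms(2,3) by (cases "mark m \<omega>" "mark n \<omega>" rule: linorder_cases) blast+
  then show ?thesis by (rule injD[OF assms(1)])
qed

lemma hold_le_clock_left: "hold y \<omega> \<le> \<Gamma>_left y r \<omega>"
  unfolding \<Gamma>_left_def jump_clock_left_def by (simp add: add.assoc)

lemma less_hold_iff: "0 \<le> t \<Longrightarrow> t < ext_rate \<gamma> y * T0 \<omega> \<longleftrightarrow> ennreal t < hold y \<omega>"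
  by (simp add: hold_def ennreal_less_iff)

lemma k_process_eq_Some_iff:
  assumes "\<omega> \<in> space M" "0 \<le> t"
  shows "k_process \<gamma> c \<sigma> T0 T y t \<omega> = Some x \<longleftrightarrow>
    (if ennreal t < hold y \<omega> then y = Some x
     else (\<exists>i. ennreal t \<in> sojourn_interval y (x, i) \<omega>) \<and>
       (\<forall>z\<in>UNIV. (\<exists>i. ennreal t \<in> sojourn_interval y (z, i) \<omega>) \<longrightarrow> z = x))"
proof -
  define P where "P z \<longleftrightarrow> (\<exists>i. ennreal t \<in> sojourn_interval y (z, i) \<omega>)" for z
  have P: "ennreal t \<in> sojourn \<gamma> c \<sigma> T0 T y z \<omega> \<longleftrightarrow> P z" for z
    by (simp only: sojourn_eq[OF assms(1)] P_def UN_iff bex_UNIV)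
  have "k_process \<gamma> c \<sigma> T0 T y t \<omega> = Some x \<longleftrightarrow>
      (if ennreal t < hold y \<omega> then y = Some x else (\<exists>!z. P z) \<and> (THE z. P z) = x)"
    unfolding k_process_def P less_hold_iff[OF assms(2)] by auto
  also have "(\<exists>!z. P z) \<and> (THE z. P z) = x \<longleftrightarrow> P x \<and> (\<forall>z\<in>UNIV. P z \<longrightarrow> z = x)"
  proof
    assume H: "(\<exists>!z. P z) \<and> (THE z. P z) = x"
    then have "P x" using theI'[of P] by auto
    then show "P x \<and> (\<forall>z\<in>UNIV. P z \<longrightarrow> z = x)" using H by auto
  qed (auto intro: the_equality)
  finally show ?thesis unfolding P_def .
qed

text \<open>At most one term of the right-hand side is nonzero: sojourn intervals are disjoint, and none of them starts before the end
of the initial holding.\<close>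

lemma k_process_indicator:
  assumes \<omega>: "\<omega> \<in> space M" and t: "0 \<le> t" and inj: "inj (\<lambda>m. mark m \<omega>)"
  shows "indicator {\<omega>'. k_process \<gamma> c \<sigma> T0 T y t \<omega>' = Some x} \<omega>
    = (if y = Some x then indicator {ennreal t<..} (hold y \<omega>) else 0)
      + (\<integral>\<^sup>+i. indicator (sojourn_interval y (x, i) \<omega>) (ennreal t) \<partial>count_space UNIV)"
proof -
  have un: "z = x" if "ennreal t \<in> sojourn_interval y (z, i) \<omega>" "ennreal t \<in> sojourn_interval y (x, i') \<omega>" for z i i'
    using sojourn_intervals_disjoint[OF inj that] by simp
  have iff: "k_process \<gamma> c \<sigma> T0 T y t \<omega> = Some x \<longleftrightarrow>
    (if ennreal t < hold y \<omega> then y = Some x else (\<exists>i. ennreal t \<in> sojourn_interval y (x, i) \<omega>))"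
    unfolding k_process_eq_Some_iff[OF \<omega> t] using un by (auto split: if_splits)
  show ?thesis
  proof (cases "ennreal t < hold y \<omega>")
    case True
    have "ennreal t \<notin> sojourn_interval y (x, i) \<omega>" for i
      using hold_le_clock_left[of y \<omega> "mark (x, i) \<omega>"] True by (auto simp: not_le)
    then have "(\<integral>\<^sup>+i. indicator (sojourn_interval y (x, i) \<omega>) (ennreal t) \<partial>count_space UNIV) = (\<integral>\<^sup>+i. 0 \<partial>count_space (UNIV :: nat set))"
      by (intro nn_integral_cong indicator_simps(2)) blast
    then show ?thesis using True by (auto simp: iff indicator_def)
  next
    case False
    show ?thesis
    proof (cases "\<exists>i. ennreal t \<in> sojourn_interval y (x, i) \<omega>")
      case True
      then obtain i0 where i0: "ennreal t \<in> sojourn_interval y (x, i0) \<omega>" by blast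
      have "ennreal t \<in> sojourn_interval y (x, i) \<omega> \<longleftrightarrow> i = i0" for i
        using sojourn_intervals_disjoint[OF inj _ i0, of "(x, i)"] i0 by auto
      then have "(\<integral>\<^sup>+i. indicator (sojourn_interval y (x, i) \<omega>) (ennreal t) \<partial>count_space UNIV)
          = (\<integral>\<^sup>+i. indicator {i0} i \<partial>count_space UNIV)"
        by (intro nn_integral_cong) (simp only: indicator_def singleton_iff)
      also have "\<dots> = 1" by simp
      finally have N: "(\<integral>\<^sup>+i. indicator (sojourn_interval y (x, i) \<omega>) (ennreal t) \<partial>count_space UNIV) = 1" .
      show ?thesis unfolding N using True False by (auto simp: iff indicator_def)
    next
      case nex: False
      then have "(\<integral>\<^sup>+i. indicator (sojourn_interval y (x, i) \<omega>) (ennreal t) \<partial>count_space UNIV) = (\<integral>\<^sup>+i. 0 \<partial>count_space (UNIV :: nat set))"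
        by (intro nn_integral_cong indicator_simps(2)) blast
      then show ?thesis using nex False by (auto simp: iff indicator_def)
    qed
  qed
qed

lemma k_process_measurable:
  assumes t: "0 \<le> t"
  shows "{\<omega> \<in> space M. k_process \<gamma> c \<sigma> T0 T y t \<omega> = z} \<in> events"
proof -
  have S: "{\<omega> \<in> space M. k_process \<gamma> c \<sigma> T0 T y t \<omega> = Some x} \<in> events" for x
  proof -
    have P: "{\<omega> \<in> space M. \<exists>i. ennreal t \<in> sojourn_interval y (z, i) \<omega>} \<in> events" for z
      by (intro sets.sets_Collect_countable_Ex) simp
    have "{\<omega> \<in> space M. k_process \<gamma> c \<sigma> T0 T y t \<omega> = Some x} =
      {\<omega> \<in> space M. (ennreal t < hold y \<omega> \<and> y = Some x) \<or> (\<not> ennreal t < hold y \<omega> \<and> ((\<exists>i. ennreal t \<in> sojourn_interval y (x, i) \<omega>) \<and>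
       (\<forall>z\<in>UNIV. (\<exists>i. ennreal t \<in> sojourn_interval y (z, i) \<omega>) \<longrightarrow> z = x)))}"
    proof (rule Collect_cong, rule conj_cong[OF refl])
      fix \<omega> assume "\<omega> \<in> space M"
      from k_process_eq_Some_iff[OF this t, of y x]
      show "k_process \<gamma> c \<sigma> T0 T y t \<omega> = Some x \<longleftrightarrow>
        (ennreal t < hold y \<omega> \<and> y = Some x) \<or> (\<not> ennreal t < hold y \<omega> \<and> ((\<exists>i. ennreal t \<in> sojourn_interval y (x, i) \<omega>) \<and>
       (\<forall>z\<in>UNIV. (\<exists>i. ennreal t \<in> sojourn_interval y (z, i) \<omega>) \<longrightarrow> z = x)))"
        by (simp only: if_bool_eq_disj)
    qed
    also have "\<dots> \<in> events"
      by (intro sets.sets_Collect_disj sets.sets_Collect_conj sets.sets_Collect_neg sets.sets_Collect_imp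
          sets.sets_Collect_countable_All' countable_states P sets.sets_Collect_const) measurable
    finally show ?thesis .
  qed
  show ?thesis
  proof (cases z)
    case None
    have "{\<omega> \<in> space M. k_process \<gamma> c \<sigma> T0 T y t \<omega> = z}
      = space M - (\<Union>x. {\<omega> \<in> space M. k_process \<gamma> c \<sigma> T0 T y t \<omega> = Some x})"
    proof (rule set_eqI)
      fix \<omega>
      show "\<omega> \<in> {\<omega> \<in> space M. k_process \<gamma> c \<sigma> T0 T y t \<omega> = z} \<longleftrightarrow>
        \<omega> \<in> space M - (\<Union>x. {\<omega> \<in> space M. k_process \<gamma> c \<sigma> T0 T y t \<omega> = Some x})"
        using None by (cases "k_process \<gamma> c \<sigma> T0 T y t \<omega>") auto
    qed
    also have "\<dots> \<in> events" using S countable_states by (intro sets.Diff sets.countable_UN'') auto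
    finally show ?thesis .
  qed (simp add: S)
qed

abbreviation p :: "real \<Rightarrow> 's option \<Rightarrow> 's option \<Rightarrow> real" where
  "p \<equiv> trans_prob M \<gamma> c \<sigma> T0 T"

lemma trans_prob_nn_integral:
  "0 \<le> t \<Longrightarrow> ennreal (p t y z) = (\<integral>\<^sup>+\<omega>. indicator {\<omega>. k_process \<gamma> c \<sigma> T0 T y t \<omega> = z} \<omega> \<partial>M)"
proof -
  assume "0 \<le> t"
  then have "(\<integral>\<^sup>+\<omega>. indicator {\<omega> \<in> space M. k_process \<gamma> c \<sigma> T0 T y t \<omega> = z} \<omega> \<partial>M) = ennreal (p t y z)"
    by (simp only: nn_integral_indicator k_process_measurable trans_prob_def emeasure_eq_measure)
  also have "(\<integral>\<^sup>+\<omega>. indicator {\<omega> \<in> space M. k_process \<gamma> c \<sigma> T0 T y t \<omega> = z} \<omega> \<partial>M)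
     = (\<integral>\<^sup>+\<omega>. indicator {\<omega>. k_process \<gamma> c \<sigma> T0 T y t \<omega> = z} \<omega> \<partial>M)"
    by (intro nn_integral_cong) (auto simp: indicator_def)
  finally show ?thesis ..
qed

lemma countable_option: "countable (UNIV :: 's option set)"
  using countable_states by (simp add: UNIV_option_conv)

lemma trans_prob_total:
  assumes t: "0 \<le> t"
  shows "(\<integral>\<^sup>+z. ennreal (p t y z) \<partial>count_space UNIV) = 1"
proof -
  have meas: "(\<lambda>\<omega>. indicator {\<omega>. k_process \<gamma> c \<sigma> T0 T y t \<omega> = z} \<omega> :: ennreal) \<in> borel_measurable M" for z
  proof -
    have "(\<lambda>\<omega>. indicator {\<omega> \<in> space M. k_process \<gamma> c \<sigma> T0 T y t \<omega> = z} \<omega> :: ennreal) \<in> borel_measurable M"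
      using k_process_measurable[OF t] by (intro borel_measurable_indicator)
    moreover have "indicator {\<omega> \<in> space M. k_process \<gamma> c \<sigma> T0 T y t \<omega> = z} \<omega>
        = (indicator {\<omega>. k_process \<gamma> c \<sigma> T0 T y t \<omega> = z} \<omega> :: ennreal)" if "\<omega> \<in> space M" for \<omega>
      using that by (simp add: indicator_def)
    ultimately show ?thesis using measurable_cong by blast
  qed
  have "(\<integral>\<^sup>+z. ennreal (p t y z) \<partial>count_space UNIV)
     = (\<integral>\<^sup>+\<omega>. \<integral>\<^sup>+z. indicator {\<omega>. k_process \<gamma> c \<sigma> T0 T y t \<omega> = z} \<omega> \<partial>count_space UNIV \<partial>M)"
    unfolding trans_prob_nn_integral[OF t]
    by (rule nn_integral_count_space_nn_integral[OF countable_option meas, symmetric])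
  also have "\<dots> = (\<integral>\<^sup>+\<omega>. \<integral>\<^sup>+z. indicator {k_process \<gamma> c \<sigma> T0 T y t \<omega>} z \<partial>count_space UNIV \<partial>M)"
    by (intro nn_integral_cong) (auto simp: indicator_def)
  finally show ?thesis by (simp add: emeasure_space_1)
qed

lemma prob_hold:
  assumes t: "0 \<le> t"
  shows "(\<integral>\<^sup>+\<omega>. indicator {ennreal t<..} (hold (Some x) \<omega>) \<partial>M)
    = ennreal (exp (- (t / \<gamma> x)))"
proof -
  have [measurable]: "T0 \<in> borel_measurable M" using T_exponential(2) by (auto simp: distributed_def)
  have iff: "ennreal t < hold (Some x) \<omega> \<longleftrightarrow> t / \<gamma> x < T0 \<omega>" for \<omega>
    using less_hold_iff[OF t, of "Some x"] \<gamma>_pos[of x] by (simp add: ext_rate_def field_simps)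
  have "(\<integral>\<^sup>+\<omega>. indicator {ennreal t<..} (hold (Some x) \<omega>) \<partial>M)
    = (\<integral>\<^sup>+\<omega>. indicator {\<omega> \<in> space M. t / \<gamma> x < T0 \<omega>} \<omega> \<partial>M)"
    using iff by (intro nn_integral_cong) (auto simp: indicator_def)
  also have "\<dots> = ennreal (exp (- (t / \<gamma> x)))"
    using exponential_distributedD_gt[OF T_exponential(2), of "t / \<gamma> x"] t \<gamma>_pos[of x]
    by (subst nn_integral_indicator) (auto simp: emeasure_eq_measure)
  finally show ?thesis .
qed

text \<open>The law of the process at a fixed time: an initial holding, or a sojourn begun at a mark.\<close>

lemma trans_prob_Some:
  assumes t: "0 \<le> t"
  shows "ennreal (p t y (Some x))
    = (if y = Some x then ennreal (exp (- (t / \<gamma> x))) else 0) + ennreal (lam x) * discounted_occupation y x t"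
proof -
  let ?h = "\<lambda>\<omega>. if y = Some x then indicator {ennreal t<..} (hold y \<omega>) else 0 :: ennreal"
  let ?s = "\<lambda>\<omega>. \<integral>\<^sup>+i. indicator (sojourn_interval y (x, i) \<omega>) (ennreal t) \<partial>count_space UNIV"
  have ind: "(\<lambda>\<omega>. indicator (sojourn_interval y m \<omega>) (ennreal t) :: ennreal) \<in> borel_measurable M" for m
  proof -
    have "(\<lambda>\<omega>. if \<Gamma>_left y (mark m \<omega>) \<omega> \<le> ennreal t \<and> ennreal t < \<Gamma> y (mark m \<omega>) \<omega> then 1 else 0 :: ennreal) \<in> borel_measurable M"
      by measurable
    also have "(\<lambda>\<omega>. if \<Gamma>_left y (mark m \<omega>) \<omega> \<le> ennreal t \<and> ennreal t < \<Gamma> y (mark m \<omega>) \<omega> then 1 else 0 :: ennreal)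
      = (\<lambda>\<omega>. indicator (sojourn_interval y m \<omega>) (ennreal t))"
      by (auto simp: fun_eq_iff indicator_def)
    finally show ?thesis .
  qed
  have h: "?h \<in> borel_measurable M"
  proof -
    have "(\<lambda>\<omega>. if y = Some x \<and> ennreal t < hold y \<omega> then 1 else 0 :: ennreal) \<in> borel_measurable M"
      by measurable
    also have "(\<lambda>\<omega>. if y = Some x \<and> ennreal t < hold y \<omega> then 1 else 0 :: ennreal) = ?h"
      by (auto simp: fun_eq_iff indicator_def)
    finally show ?thesis .
  qed
  have "ennreal (p t y (Some x)) = (\<integral>\<^sup>+\<omega>. ?h \<omega> + ?s \<omega> \<partial>M)"
    unfolding trans_prob_nn_integral[OF t]
    using AE_marks_distinct AE_space
    by (intro nn_integral_cong_AE, eventually_elim) (rule k_process_indicator[OF _ t])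
  also have "\<dots> = (\<integral>\<^sup>+\<omega>. ?h \<omega> \<partial>M) + (\<integral>\<^sup>+\<omega>. ?s \<omega> \<partial>M)"
    by (intro nn_integral_add h borel_measurable_nn_integral_count_space ind) simp
  also have "(\<integral>\<^sup>+\<omega>. ?s \<omega> \<partial>M) = ennreal (lam x) * discounted_occupation y x t"
    unfolding sojourn_prob[OF t, symmetric]
    by (rule nn_integral_count_space_nn_integral) (simp_all add: ind)
  also have "(\<integral>\<^sup>+\<omega>. ?h \<omega> \<partial>M) = (if y = Some x then ennreal (exp (- (t / \<gamma> x))) else 0)"
    using prob_hold[OF t] by simp
  finally show ?thesis .
qed

section \<open>Linear relations between occupation functions\<close>

text \<open>The potential of the clock: the expected time that it spends at or below the level \<open>t\<close>.\<close>

definition occupation :: "'s option \<Rightarrow> real \<Rightarrow> ennreal" where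
  "occupation y t = (\<integral>\<^sup>+s. indicator {0..} s * (\<integral>\<^sup>+\<omega>. indicator {..ennreal t} (\<Gamma> y s \<omega>) \<partial>M) \<partial>lborel)"

text \<open>The pair of a time and a path, with a sigma-finite measure, so that the expectation of an integral over time becomes a
single integral to which Tonelli's theorem applies.\<close>

definition clock_space :: "(real \<times> 'w) measure" where
  "clock_space = density lborel (indicator {0..}) \<Otimes>\<^sub>M M"

sublocale clock_space: sigma_finite_measure clock_space
proof -
  interpret L: sigma_finite_measure "density lborel (indicator {0::real..} :: real \<Rightarrow> ennreal)"
    by (subst sigma_finite_measure.sigma_finite_iff_density_finite[OF sigma_finite_lborel]) (auto simp: indicator_def)
  interpret pair_sigma_finite "density lborel (indicator {0::real..} :: real \<Rightarrow> ennreal)" M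
    by unfold_locales
  show "sigma_finite_measure clock_space"
    unfolding clock_space_def by unfold_locales
qed

lemma clock_space_measurable [measurable]:
  "(\<lambda>p. \<Gamma> y (fst p) (snd p)) \<in> borel_measurable clock_space"
  using measurable_clock[of y] unfolding clock_space_def
  by (simp cong: measurable_cong_sets sets_pair_measure_cong)

lemma nn_integral_clock_space:
  assumes [measurable]: "f \<in> borel_measurable borel"
  shows "(\<integral>\<^sup>+p. f (\<Gamma> y (fst p) (snd p)) \<partial>clock_space)
    = (\<integral>\<^sup>+s. indicator {0..} s * (\<integral>\<^sup>+\<omega>. f (\<Gamma> y s \<omega>) \<partial>M) \<partial>lborel)"
proof -
  note clock_space_measurable[unfolded clock_space_def, measurable]
  have "(\<integral>\<^sup>+p. f (\<Gamma> y (fst p) (snd p)) \<partial>clock_space)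
    = (\<integral>\<^sup>+s. \<integral>\<^sup>+\<omega>. f (\<Gamma> y s \<omega>) \<partial>M \<partial>density lborel (indicator {0..}))"
    unfolding clock_space_def by (subst nn_integral_fst[symmetric]) auto
  also have "\<dots> = (\<integral>\<^sup>+s. indicator {0..} s * (\<integral>\<^sup>+\<omega>. f (\<Gamma> y s \<omega>) \<partial>M) \<partial>lborel)"
    by (subst nn_integral_density) auto
  finally show ?thesis .
qed

lemma discounted_occupation_clock_space: "discounted_occupation y x t = (\<integral>\<^sup>+p. decay x t (\<Gamma> y (fst p) (snd p)) \<partial>clock_space)"
  unfolding discounted_occupation_def by (rule nn_integral_clock_space[symmetric]) measurable

lemma occupation_clock_space:
  "occupation y t = (\<integral>\<^sup>+p. indicator {..ennreal t} (\<Gamma> y (fst p) (snd p)) \<partial>clock_space)"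
  unfolding occupation_def by (rule nn_integral_clock_space[symmetric]) measurable

text \<open>For \<open>v \<le> t\<close> the integral is the probability that an exponential variable of mean \<open>\<gamma> x\<close> is at most
\<open>t - v\<close>, and \<open>decay x t v\<close> is the complementary probability.\<close>

lemma decay_resolvent:
  assumes t: "0 \<le> t"
  shows "decay x t v + (\<integral>\<^sup>+u. indicator {0..t} u * (ennreal (1 / \<gamma> x) * decay x u v) \<partial>lborel)
    = indicator {..ennreal t} v"
proof (cases "v \<le> ennreal t")
  case True
  then obtain b where b: "v = ennreal b" "0 \<le> b" "b \<le> t"
    using t by (cases v) (auto simp: top_unique)
  let ?F = "\<lambda>u. - exp (- ((u - b) / \<gamma> x))"
  have g: "0 < \<gamma> x" by (rule \<gamma>_pos)
  have "(\<integral>\<^sup>+u. indicator {0..t} u * (ennreal (1 / \<gamma> x) * decay x u v) \<partial>lborel)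
    = (\<integral>\<^sup>+u. ennreal (exp (- ((u - b) / \<gamma> x)) / \<gamma> x) * indicator {b..t} u \<partial>lborel)"
    using b g by (intro nn_integral_cong) (auto simp: decay_def indicator_def ennreal_mult'[symmetric])
  also have "\<dots> = ennreal (?F t - ?F b)"
    using b g by (intro nn_integral_FTC_Icc) (auto intro!: derivative_eq_intros simp: field_simps)
  also have "decay x t v + ennreal (?F t - ?F b) = ennreal 1"
    using b g True by (simp add: decay_def flip: ennreal_plus)
  finally show ?thesis using True by simp
next
  case False
  have "indicator {0..t} u * (ennreal (1 / \<gamma> x) * decay x u v) = 0" for u
    using False order_trans[OF _ ennreal_leI, of v u t] by (auto simp: decay_def indicator_def)
  then have "(\<integral>\<^sup>+u. indicator {0..t} u * (ennreal (1 / \<gamma> x) * decay x u v) \<partial>lborel) = 0"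
    by (simp only: nn_integral_const mult_zero_left)
  then show ?thesis using False by (simp add: decay_def)
qed

text \<open>Inverse to the previous relation: here the decay is recovered from the indicators of the levels below \<open>t\<close>.\<close>

lemma decay_inverse_resolvent:
  assumes t: "0 \<le> t"
  shows "decay x t v + (\<integral>\<^sup>+u. indicator {0..t} u * ennreal (exp (- ((t - u) / \<gamma> x)) / \<gamma> x)
      * indicator {..ennreal u} v \<partial>lborel) = indicator {..ennreal t} v"
proof (cases "v \<le> ennreal t")
  case True
  then obtain b where b: "v = ennreal b" "0 \<le> b" "b \<le> t"
    using t by (cases v) (auto simp: top_unique)
  let ?F = "\<lambda>u. exp (- ((t - u) / \<gamma> x))"
  have g: "0 < \<gamma> x" by (rule \<gamma>_pos)
  have "(\<integral>\<^sup>+u. indicator {0..t} u * ennreal (exp (- ((t - u) / \<gamma> x)) / \<gamma> x) * indicator {..ennreal u} v \<partial>lborel)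
    = (\<integral>\<^sup>+u. ennreal (exp (- ((t - u) / \<gamma> x)) / \<gamma> x) * indicator {b..t} u \<partial>lborel)"
    using b g by (intro nn_integral_cong) (auto simp: indicator_def)
  also have "\<dots> = ennreal (?F t - ?F b)"
    using b g by (intro nn_integral_FTC_Icc) (auto intro!: derivative_eq_intros simp: field_simps)
  also have "decay x t v + ennreal (?F t - ?F b) = ennreal 1"
    using b g True by (simp add: decay_def flip: ennreal_plus)
  finally show ?thesis using True by simp
next
  case False
  have "indicator {0..t} u * ennreal (exp (- ((t - u) / \<gamma> x)) / \<gamma> x) * indicator {..ennreal u} v = 0" for u
    using False order_trans[OF _ ennreal_leI, of v u t] by (auto simp: indicator_def)
  then have "(\<integral>\<^sup>+u. indicator {0..t} u * ennreal (exp (- ((t - u) / \<gamma> x)) / \<gamma> x) * indicator {..ennreal u} v \<partial>lborel) = 0"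
    by (simp only: nn_integral_const mult_zero_left)
  then show ?thesis using False by (simp add: decay_def)
qed

lemma measurable_decay_pair [measurable]:
  assumes [measurable]: "f \<in> borel_measurable N" "g \<in> borel_measurable N"
  shows "(\<lambda>q. decay x (f q) (g q)) \<in> borel_measurable N"
  unfolding decay_def by measurable

lemma discounted_occupation_measurable [measurable]: "discounted_occupation y x \<in> borel_measurable borel"
  unfolding discounted_occupation_clock_space[abs_def] by measurable

lemma occupation_measurable [measurable]: "occupation y \<in> borel_measurable borel"
proof -
  have "occupation y = (\<lambda>t. \<integral>\<^sup>+p. (if \<Gamma> y (fst p) (snd p) \<le> ennreal t then 1 else 0) \<partial>clock_space)"
    unfolding occupation_clock_space by (intro ext nn_integral_cong) (simp add: indicator_def)
  also have "\<dots> \<in> borel_measurable borel" by measurable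
  finally show ?thesis .
qed

lemma discounted_occupation_equation:
  assumes t: "0 \<le> t"
  shows "discounted_occupation y x t + (\<integral>\<^sup>+u. indicator {0..t} u * (ennreal (1 / \<gamma> x) * discounted_occupation y x u) \<partial>lborel) = occupation y t"
proof -
  interpret P: pair_sigma_finite lborel clock_space by unfold_locales
  have "(\<integral>\<^sup>+u. indicator {0..t} u * (ennreal (1 / \<gamma> x) * discounted_occupation y x u) \<partial>lborel)
    = (\<integral>\<^sup>+u. \<integral>\<^sup>+p. indicator {0..t} u * (ennreal (1 / \<gamma> x) * decay x u (\<Gamma> y (fst p) (snd p))) \<partial>clock_space \<partial>lborel)"
    unfolding discounted_occupation_clock_space by (intro nn_integral_cong) (simp add: nn_integral_cmult)
  also have "\<dots> = (\<integral>\<^sup>+p. \<integral>\<^sup>+u. indicator {0..t} u * (ennreal (1 / \<gamma> x) * decay x u (\<Gamma> y (fst p) (snd p))) \<partial>lborel \<partial>clock_space)"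
    by (rule P.Fubini'[symmetric]) measurable
  finally show ?thesis
    unfolding occupation_clock_space discounted_occupation_clock_space decay_resolvent[OF t, symmetric, of _ x]
    by (subst nn_integral_add) auto
qed

lemma discounted_occupation_inverse_equation:
  assumes t: "0 \<le> t"
  shows "discounted_occupation y x t + (\<integral>\<^sup>+u. indicator {0..t} u * ennreal (exp (- ((t - u) / \<gamma> x)) / \<gamma> x) * occupation y u \<partial>lborel)
    = occupation y t"
proof -
  interpret P: pair_sigma_finite lborel clock_space by unfold_locales
  let ?k = "\<lambda>u. indicator {0..t} u * ennreal (exp (- ((t - u) / \<gamma> x)) / \<gamma> x) :: ennreal"
  have m: "(\<lambda>(u, p). ?k u * indicator {..ennreal u} (\<Gamma> y (fst p) (snd p))) \<in> borel_measurable (lborel \<Otimes>\<^sub>M clock_space)"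
  proof -
    have "(\<lambda>q. ?k (fst q) * (if \<Gamma> y (fst (snd q)) (snd (snd q)) \<le> ennreal (fst q) then 1 else 0)) \<in> borel_measurable (lborel \<Otimes>\<^sub>M clock_space)"
      by measurable
    then show ?thesis by (simp add: split_beta' indicator_def of_bool_def)
  qed
  have "(\<integral>\<^sup>+u. ?k u * occupation y u \<partial>lborel)
    = (\<integral>\<^sup>+u. \<integral>\<^sup>+p. ?k u * indicator {..ennreal u} (\<Gamma> y (fst p) (snd p)) \<partial>clock_space \<partial>lborel)"
    unfolding occupation_clock_space by (intro nn_integral_cong nn_integral_cmult[symmetric]) measurable
  also have "\<dots> = (\<integral>\<^sup>+p. \<integral>\<^sup>+u. ?k u * indicator {..ennreal u} (\<Gamma> y (fst p) (snd p)) \<partial>lborel \<partial>clock_space)"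
    by (rule P.Fubini'[OF m, symmetric])
  finally have 1: "(\<integral>\<^sup>+u. ?k u * occupation y u \<partial>lborel) = \<dots>" .
  have "(\<lambda>p. \<integral>\<^sup>+u. ?k u * indicator {..ennreal u} (\<Gamma> y (fst p) (snd p)) \<partial>lborel) \<in> borel_measurable clock_space"
    using borel_measurable_nn_integral_swapped[OF sigma_finite_lborel m] by simp
  then show ?thesis
    unfolding 1 unfolding occupation_clock_space[of y t] discounted_occupation_clock_space decay_inverse_resolvent[OF t, symmetric, of _ x]
    by (subst nn_integral_add) auto
qed

lemma discounted_occupation_lower_bound:
  assumes t: "0 \<le> t"
  shows "ennreal (exp (- (t / \<gamma> x))) * occupation y t \<le> discounted_occupation y x t"
proof -
  have "ennreal (exp (- (t / \<gamma> x))) * indicator {..ennreal t} v \<le> decay x t v" for v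
    using \<gamma>_pos[of x] t
    by (cases v) (auto simp: decay_def indicator_def divide_right_mono top_unique intro!: ennreal_leI)
  then show ?thesis
    unfolding occupation_clock_space discounted_occupation_clock_space
    by (subst nn_integral_cmult[symmetric]) (auto intro!: nn_integral_mono)
qed

lemma discounted_occupation_finite: 
  assumes "0 \<le> t"
  shows "discounted_occupation y x t < \<infinity>"
proof -
  have "ennreal (lam x) * discounted_occupation y x t \<le> ennreal (p t y (Some x))"
    unfolding trans_prob_Some[OF assms] by simp
  then have "ennreal (lam x) * discounted_occupation y x t < \<infinity>" by (auto intro: le_less_trans)
  then show ?thesis using lam_pos[of x] by (auto simp: ennreal_mult_less_top)
qed

text \<open>Transition probabilities are at most one, and they dominate a positive multiple of the occupation. This is the reason why
the clock almost surely exceeds every level.\<close>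

lemma occupation_finite: 
  assumes t: "0 \<le> t"
  shows "occupation y t < \<infinity>"
proof -
  obtain x :: 's where True by auto
  have "ennreal (exp (- (t / \<gamma> x))) * occupation y t < \<infinity>"
    using discounted_occupation_lower_bound[OF t, of x y] discounted_occupation_finite[OF t, of y x] by (rule le_less_trans)
  then show ?thesis by (auto simp: ennreal_mult_less_top ennreal_eq_0_iff not_le)
qed

text \<open>Started from \<open>Some x\<close>, the clock is delayed by an independent exponential time of mean \<open>\<gamma> x\<close>. The probability
that the delayed value is at most \<open>t\<close> is the integral of the decay from \<open>decay_resolvent\<close>.\<close>

lemma occupation_Some_eq:
  assumes t: "0 \<le> t"
  shows "occupation (Some x) t = (\<integral>\<^sup>+u. indicator {0..t} u * (ennreal (1 / \<gamma> x) * discounted_occupation None x u) \<partial>lborel)"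
proof -
  interpret P: pair_sigma_finite lborel clock_space by unfold_locales
  define K where "K v = (\<integral>\<^sup>+u. indicator {0..t} u * (ennreal (1 / \<gamma> x) * decay x u v) \<partial>lborel)" for v
  have [measurable]: "K \<in> borel_measurable borel" unfolding K_def by measurable
  have [measurable]: "T0 \<in> borel_measurable M" using T_exponential(2) by (auto simp: distributed_def)
  have "(\<integral>\<^sup>+\<omega>. indicator {..ennreal t} (\<Gamma> (Some x) s \<omega>) \<partial>M) = (\<integral>\<^sup>+\<omega>. K (\<Gamma> None s \<omega>) \<partial>M)" for s
  proof -
    let ?R = "rest_alg (Inr None)"
    let ?H = "\<lambda>u \<omega>. indicator {..ennreal t} (\<Gamma> None s \<omega> + ennreal (\<gamma> x * u)) :: ennreal"
    note measurable_clock_rest[measurable]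
    have H: "case_prod ?H \<in> borel_measurable (borel \<Otimes>\<^sub>M ?R)" by measurable
    have X: "T0 \<in> borel_measurable (own_alg (Inr None))"
      using measurable_exp_own[of None] by (simp add: exp_family_def)
    have "\<Gamma> (Some x) s \<omega> = \<Gamma> None s \<omega> + ennreal (\<gamma> x * T0 \<omega>)" for \<omega>
      by (simp add: \<Gamma>_def jump_clock_def hold_def ext_rate_def ac_simps)
    then have "(\<integral>\<^sup>+\<omega>. indicator {..ennreal t} (\<Gamma> (Some x) s \<omega>) \<partial>M) = (\<integral>\<^sup>+\<omega>. ?H (T0 \<omega>) \<omega> \<partial>M)"
      by simp
    also have "\<dots> = (\<integral>\<^sup>+\<omega>. \<integral>\<^sup>+\<omega>'. ?H (T0 \<omega>') \<omega> \<partial>M \<partial>M)"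
      by (rule own_rest_fubini'[OF Inr_index(1) X H])
    also have "\<dots> = (\<integral>\<^sup>+\<omega>. K (\<Gamma> None s \<omega>) \<partial>M)"
    proof (intro nn_integral_cong)
      fix \<omega>
      define v where "v = \<Gamma> None s \<omega>"
      have strad: "(\<integral>\<^sup>+\<omega>'. indicator {v..<v + ennreal (\<gamma> x * T0 \<omega>')} (ennreal t) \<partial>M) = decay x t v"
        by (rule prob_straddle[OF t _ T_exponential(2)]) measurable
      have "decay x t v + (\<integral>\<^sup>+\<omega>'. indicator {..ennreal t} (v + ennreal (\<gamma> x * T0 \<omega>')) \<partial>M)
        = (\<integral>\<^sup>+\<omega>'. indicator {v..<v + ennreal (\<gamma> x * T0 \<omega>')} (ennreal t) + indicator {..ennreal t} (v + ennreal (\<gamma> x * T0 \<omega>')) \<partial>M)"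
      proof -
        have m: "(\<lambda>\<omega>'. indicator {v..<v + ennreal (\<gamma> x * T0 \<omega>')} (ennreal t) :: ennreal) \<in> borel_measurable M"
        proof -
          have "(\<lambda>\<omega>'. if v \<le> ennreal t \<and> ennreal t < v + ennreal (\<gamma> x * T0 \<omega>') then 1 else 0 :: ennreal) \<in> borel_measurable M"
            by measurable
          then show ?thesis by (simp add: indicator_def of_bool_def)
        qed
        show ?thesis by (subst nn_integral_add[OF m]) (auto simp: strad)
      qed
      also have "\<dots> = (\<integral>\<^sup>+\<omega>'. indicator {..ennreal t} v \<partial>M)"
      proof (intro nn_integral_cong)
        fix \<omega>'
        have "v \<le> v + ennreal (\<gamma> x * T0 \<omega>')" by simp
        then show "indicator {v..<v + ennreal (\<gamma> x * T0 \<omega>')} (ennreal t) + indicator {..ennreal t} (v + ennreal (\<gamma> x * T0 \<omega>')) = (indicator {..ennreal t} v :: ennreal)"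
          by (auto simp: indicator_def intro: order_trans[OF \<open>v \<le> v + ennreal (\<gamma> x * T0 \<omega>')\<close>])
      qed
      also have "\<dots> = decay x t v + K v"
        unfolding K_def decay_resolvent[OF t] by (simp add: emeasure_space_1)
      finally show "(\<integral>\<^sup>+\<omega>'. ?H (T0 \<omega>') \<omega> \<partial>M) = K (\<Gamma> None s \<omega>)"
        unfolding v_def by (auto simp: ennreal_add_left_cancel decay_def split: if_splits)
    qed
    finally show ?thesis .
  qed
  then have "occupation (Some x) t = (\<integral>\<^sup>+p. K (\<Gamma> None (fst p) (snd p)) \<partial>clock_space)"
    unfolding occupation_def by (subst nn_integral_clock_space) simp_all
  also have "\<dots> = (\<integral>\<^sup>+u. \<integral>\<^sup>+p. indicator {0..t} u * (ennreal (1 / \<gamma> x) * decay x u (\<Gamma> None (fst p) (snd p))) \<partial>clock_space \<partial>lborel)"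
    unfolding K_def by (rule P.Fubini') measurable
  also have "\<dots> = (\<integral>\<^sup>+u. indicator {0..t} u * (ennreal (1 / \<gamma> x) * discounted_occupation None x u) \<partial>lborel)"
    unfolding discounted_occupation_clock_space by (intro nn_integral_cong) (simp add: nn_integral_cmult)
  finally show ?thesis .
qed

text \<open>The expectation of the pathwise decomposition of \<open>[0, t]\<close>. The part covered by the sojourns of \<open>x\<close> is the
integral of their probability, which by \<open>sojourn_prob\<close> and \<open>occupation_Some_eq\<close> is a multiple of the occupation
for the start in \<open>Some x\<close>.\<close>

lemma time_balance:
  assumes t: "0 \<le> t"
  shows "ennreal t = ennreal c * occupation None t
    + (\<integral>\<^sup>+x. ennreal (lam x * \<gamma> x) * occupation (Some x) t \<partial>count_space UNIV)"
proof -
  interpret LM: pair_sigma_finite lborel M by unfold_locales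
  let ?E = "\<lambda>\<omega>. {r. 0 \<le> r \<and> \<Gamma> None r \<omega> \<le> ennreal t}"
  let ?I = "\<lambda>m u \<omega>. indicator {0..t} u * indicator (sojourn_interval None m \<omega>) (ennreal u) :: ennreal"
  have Gm [measurable]: "(\<lambda>q. \<Gamma> None (fst q) (snd q)) \<in> borel_measurable (lborel \<Otimes>\<^sub>M M)"
    using measurable_clock[of None] by (simp cong: measurable_cong_sets sets_pair_measure_cong)
  have Em: "(\<lambda>q. if 0 \<le> fst q \<and> \<Gamma> None (fst q) (snd q) \<le> ennreal t then 1 else 0 :: ennreal) \<in> borel_measurable (lborel \<Otimes>\<^sub>M M)"
    by measurable
  have E1: "emeasure lborel (?E \<omega>) = (\<integral>\<^sup>+s. (if 0 \<le> s \<and> \<Gamma> None s \<omega> \<le> ennreal t then 1 else 0) \<partial>lborel)" if "\<omega> \<in> space M" for \<omega>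
  proof -
    have [measurable]: "(\<lambda>s. \<Gamma> None s \<omega>) \<in> borel_measurable lborel"
      using measurable_Pair1[OF Gm that] by simp
    have "?E \<omega> \<in> sets lborel" by measurable
    then have "emeasure lborel (?E \<omega>) = (\<integral>\<^sup>+s. indicator (?E \<omega>) s \<partial>lborel)" by simp
    then show ?thesis by (simp add: indicator_def of_bool_def)
  qed
  have occ: "(\<integral>\<^sup>+\<omega>. emeasure lborel (?E \<omega>) \<partial>M) = occupation None t"
  proof -
    have "(\<integral>\<^sup>+\<omega>. emeasure lborel (?E \<omega>) \<partial>M) = (\<integral>\<^sup>+\<omega>. \<integral>\<^sup>+s. (if 0 \<le> s \<and> \<Gamma> None s \<omega> \<le> ennreal t then 1 else 0) \<partial>lborel \<partial>M)"
      using E1 by (intro nn_integral_cong)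
    also have "\<dots> = (\<integral>\<^sup>+s. \<integral>\<^sup>+\<omega>. (if 0 \<le> s \<and> \<Gamma> None s \<omega> \<le> ennreal t then 1 else 0) \<partial>M \<partial>lborel)"
      by (rule LM.Fubini') (use Em in \<open>simp add: split_beta'\<close>)
    also have "\<dots> = occupation None t"
      unfolding occupation_def by (intro nn_integral_cong) (auto simp: indicator_def of_bool_def)
    finally show ?thesis .
  qed
  have Emeas: "(\<lambda>\<omega>. emeasure lborel (?E \<omega>)) \<in> borel_measurable M"
  proof -
    have "(\<lambda>\<omega>. \<integral>\<^sup>+s. (if 0 \<le> s \<and> \<Gamma> None s \<omega> \<le> ennreal t then 1 else 0 :: ennreal) \<partial>lborel) \<in> borel_measurable M"
      using borel_measurable_nn_integral_swapped[OF sigma_finite_lborel Em] by simp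
    then show ?thesis by (subst measurable_cong[OF E1])
  qed
  have AEfin: "AE \<omega> in M. emeasure lborel (?E \<omega>) < \<infinity>"
  proof -
    have "AE \<omega> in M. emeasure lborel (?E \<omega>) \<noteq> \<infinity>"
      using occ occupation_finite[OF t, of None] by (intro nn_integral_PInf_AE[OF Emeas]) auto
    then show ?thesis by (simp add: top.not_eq_extremum)
  qed
  have Im: "(\<lambda>q. ?I m (fst q) (snd q)) \<in> borel_measurable (lborel \<Otimes>\<^sub>M M)" for m
  proof -
    have "(\<lambda>q. indicator {0..t} (fst q) * (if \<Gamma>_left None (mark m (snd q)) (snd q) \<le> ennreal (fst q) \<and> ennreal (fst q) < \<Gamma> None (mark m (snd q)) (snd q) then 1 else 0) :: ennreal) \<in> borel_measurable (lborel \<Otimes>\<^sub>M M)"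
      by measurable
    then show ?thesis by (simp add: indicator_def[of "sojourn_interval _ _ _"] of_bool_def)
  qed
  have Im2: "(\<lambda>\<omega>. \<integral>\<^sup>+u. ?I m u \<omega> \<partial>lborel) \<in> borel_measurable M" for m
    using borel_measurable_nn_integral_swapped[OF sigma_finite_lborel Im[of m]] by simp
  have path: "AE \<omega> in M. ennreal t = ennreal c * emeasure lborel (?E \<omega>) + (\<integral>\<^sup>+m. (\<integral>\<^sup>+u. ?I m u \<omega> \<partial>lborel) \<partial>count_space UNIV)"
    using AEfin AE_marks_distinct AE_clock_finite AE_space
  proof eventually_elim
    case (elim \<omega>)
    have h0: "hold None \<omega> = 0" by (simp add: hold_def ext_rate_def)
    have pos: "0 < mark m \<omega>" for m by (rule mark_pos) fact
    have fin: "jump_clock (\<lambda>m. mark m \<omega>) (\<lambda>m. jump m \<omega>) 0 c r < \<infinity>" for r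
      using elim(3) unfolding \<Gamma>_def by (metis h0)
    show ?case
      using jump_clock_time_decomposition[of c t "\<lambda>m. mark m \<omega>" "\<lambda>m. jump m \<omega>", OF c_nonneg t elim(2) pos fin] elim(1)
      unfolding \<Gamma>_def \<Gamma>_left_def h0 by blast
  qed
  have "ennreal t = (\<integral>\<^sup>+\<omega>. ennreal t \<partial>M)" by (simp add: emeasure_space_1)
  also have "\<dots> = (\<integral>\<^sup>+\<omega>. ennreal c * emeasure lborel (?E \<omega>) + (\<integral>\<^sup>+m. (\<integral>\<^sup>+u. ?I m u \<omega> \<partial>lborel) \<partial>count_space UNIV) \<partial>M)"
    using path by (rule nn_integral_cong_AE)
  also have "\<dots> = (\<integral>\<^sup>+\<omega>. ennreal c * emeasure lborel (?E \<omega>) \<partial>M) + (\<integral>\<^sup>+\<omega>. (\<integral>\<^sup>+m. (\<integral>\<^sup>+u. ?I m u \<omega> \<partial>lborel) \<partial>count_space UNIV) \<partial>M)"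
    using Emeas by (intro nn_integral_add borel_measurable_nn_integral_count_space[OF countable_marks] Im2) auto
  also have "(\<integral>\<^sup>+\<omega>. ennreal c * emeasure lborel (?E \<omega>) \<partial>M) = ennreal c * occupation None t"
    using Emeas by (simp add: nn_integral_cmult occ)
  also have "(\<integral>\<^sup>+\<omega>. (\<integral>\<^sup>+m. (\<integral>\<^sup>+u. ?I m u \<omega> \<partial>lborel) \<partial>count_space UNIV) \<partial>M)
    = (\<integral>\<^sup>+m. \<integral>\<^sup>+\<omega>. \<integral>\<^sup>+u. ?I m u \<omega> \<partial>lborel \<partial>M \<partial>count_space UNIV)"
    by (rule nn_integral_count_space_nn_integral[OF countable_marks Im2])
  also have "\<dots> = (\<integral>\<^sup>+m. \<integral>\<^sup>+u. \<integral>\<^sup>+\<omega>. ?I m u \<omega> \<partial>M \<partial>lborel \<partial>count_space UNIV)"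
    using Im by (intro nn_integral_cong LM.Fubini') (simp add: split_beta')
  also have "\<dots> = (\<integral>\<^sup>+x. \<integral>\<^sup>+i. \<integral>\<^sup>+u. \<integral>\<^sup>+\<omega>. ?I (x, i) u \<omega> \<partial>M \<partial>lborel \<partial>count_space UNIV \<partial>count_space UNIV)"
    by (rule nn_integral_fst_count_space[symmetric])
  also have "\<dots> = (\<integral>\<^sup>+x. \<integral>\<^sup>+u. \<integral>\<^sup>+i. \<integral>\<^sup>+\<omega>. ?I (x, i) u \<omega> \<partial>M \<partial>count_space UNIV \<partial>lborel \<partial>count_space UNIV)"
    using borel_measurable_nn_integral_fst[OF Im]
    by (intro nn_integral_cong nn_integral_count_space_nn_integral[symmetric]) simp_all
  also have "\<dots> = (\<integral>\<^sup>+x. \<integral>\<^sup>+u. indicator {0..t} u * (ennreal (lam x) * discounted_occupation None x u) \<partial>lborel \<partial>count_space UNIV)"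
  proof (intro nn_integral_cong)
    fix x u
    show "(\<integral>\<^sup>+i. \<integral>\<^sup>+\<omega>. ?I (x, i) u \<omega> \<partial>M \<partial>count_space UNIV) = indicator {0..t} u * (ennreal (lam x) * discounted_occupation None x u)"
    proof (cases "u \<in> {0..t}")
      case True
      then show ?thesis using sojourn_prob[of u None x] by simp
    qed simp
  qed
  also have "\<dots> = (\<integral>\<^sup>+x. ennreal (lam x * \<gamma> x) * occupation (Some x) t \<partial>count_space UNIV)"
  proof (intro nn_integral_cong)
    fix x
    have "ennreal (lam x) = ennreal (lam x * \<gamma> x) * ennreal (1 / \<gamma> x)"
      using lam_pos[of x] \<gamma>_pos[of x] by (simp flip: ennreal_mult)
    then show "(\<integral>\<^sup>+u. indicator {0..t} u * (ennreal (lam x) * discounted_occupation None x u) \<partial>lborel)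
      = ennreal (lam x * \<gamma> x) * occupation (Some x) t"
      unfolding occupation_Some_eq[OF t] by (subst nn_integral_cmult[symmetric]) (auto simp: ac_simps)
  qed
  finally show ?thesis .
qed

lemma occupation_Some_le: "occupation (Some x) t \<le> occupation None t"
proof -
  have "\<Gamma> None s \<omega> \<le> \<Gamma> (Some x) s \<omega>" for s \<omega>
    by (simp add: \<Gamma>_def jump_clock_def hold_def ext_rate_def add_right_mono)
  then show ?thesis
    unfolding occupation_def
    by (intro nn_integral_mono mult_left_mono) (auto simp: indicator_def dest: order_trans)
qed

lemma infinite_option: "infinite (UNIV :: 's option set)"
  using infinite_states by (simp add: UNIV_option_conv finite_image_iff)

section \<open>Invariant distributions\<close>

text \<open>The occupation function for a random initial state with law \<open>\<mu>\<close>.\<close>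

definition mixed_occupation :: "'s option pmf \<Rightarrow> real \<Rightarrow> ennreal" where
  "mixed_occupation \<mu> t = (\<integral>\<^sup>+y. ennreal (pmf \<mu> y) * occupation y t \<partial>count_space UNIV)"

definition mixed_discounted_occupation :: "'s option pmf \<Rightarrow> 's \<Rightarrow> real \<Rightarrow> ennreal" where
  "mixed_discounted_occupation \<mu> x t = (\<integral>\<^sup>+y. ennreal (pmf \<mu> y) * discounted_occupation y x t \<partial>count_space UNIV)"

lemma mixed_integral:
  assumes [measurable]: "k \<in> borel_measurable borel" "\<And>y. f y \<in> borel_measurable borel"
  shows "(\<integral>\<^sup>+u. k u * (\<integral>\<^sup>+y. ennreal (pmf \<mu> y) * f y u \<partial>count_space UNIV) \<partial>lborel)
    = (\<integral>\<^sup>+y. ennreal (pmf \<mu> y) * (\<integral>\<^sup>+u. k u * f y u \<partial>lborel) \<partial>count_space (UNIV :: 's option set))"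
proof -
  have "(\<integral>\<^sup>+u. k u * (\<integral>\<^sup>+y. ennreal (pmf \<mu> y) * f y u \<partial>count_space UNIV) \<partial>lborel)
    = (\<integral>\<^sup>+u. \<integral>\<^sup>+y. ennreal (pmf \<mu> y) * (k u * f y u) \<partial>count_space UNIV \<partial>lborel)"
    by (intro nn_integral_cong) (simp add: nn_integral_cmult[symmetric] ac_simps)
  also have "\<dots> = (\<integral>\<^sup>+y. \<integral>\<^sup>+u. ennreal (pmf \<mu> y) * (k u * f y u) \<partial>lborel \<partial>count_space UNIV)"
    by (intro nn_integral_count_space_nn_integral countable_option) measurable
  finally show ?thesis by (simp add: nn_integral_cmult)
qed

lemma mixed_discounted_occupation_equation:
  assumes t: "0 \<le> t"
  shows "mixed_discounted_occupation \<mu> x t + (\<integral>\<^sup>+u. indicator {0..t} u * ennreal (1 / \<gamma> x) * mixed_discounted_occupation \<mu> x u \<partial>lborel)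
    = mixed_occupation \<mu> t"
  unfolding mixed_discounted_occupation_def mixed_occupation_def discounted_occupation_equation[OF t, symmetric, of _ x]
  by (subst mixed_integral) (auto simp: nn_integral_add[symmetric] distrib_left mult.assoc)

lemma mixed_discounted_occupation_inverse_equation:
  assumes t: "0 \<le> t"
  shows "mixed_discounted_occupation \<mu> x t + (\<integral>\<^sup>+u. indicator {0..t} u * ennreal (exp (- ((t - u) / \<gamma> x)) / \<gamma> x)
      * mixed_occupation \<mu> u \<partial>lborel) = mixed_occupation \<mu> t"
  unfolding mixed_discounted_occupation_def
  unfolding mixed_occupation_def[of _ t] discounted_occupation_inverse_equation[OF t, symmetric, of _ x]
  unfolding mixed_occupation_def
  by (subst mixed_integral) (auto simp: nn_integral_add[symmetric] distrib_left)

lemma mixed_occupation_split: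
  "mixed_occupation \<mu> t = ennreal (pmf \<mu> None) * occupation None t
    + (\<integral>\<^sup>+x. ennreal (pmf \<mu> (Some x)) * occupation (Some x) t \<partial>count_space UNIV)"
  unfolding mixed_occupation_def by (rule nn_integral_count_space_option)

lemma invariant_iff:
  "invariant_pmf p \<mu> \<longleftrightarrow>
    (\<forall>t>0. \<forall>z. (\<integral>\<^sup>+y. ennreal (pmf \<mu> y) * ennreal (p t y z) \<partial>count_space UNIV) = ennreal (pmf \<mu> z))"
  unfolding invariant_pmf_def
  by (subst has_sum_iff_nn_integral[OF countable_option infinite_option])
    (auto simp: trans_prob_def ennreal_mult)

lemma mixed_trans_prob_Some:
  assumes t: "0 \<le> t"
  shows "(\<integral>\<^sup>+y. ennreal (pmf \<mu> y) * ennreal (p t y (Some x)) \<partial>count_space UNIV)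
    = ennreal (pmf \<mu> (Some x) * exp (- (t / \<gamma> x))) + ennreal (lam x) * mixed_discounted_occupation \<mu> x t"
proof -
  have "(\<integral>\<^sup>+y. ennreal (pmf \<mu> y) * ennreal (p t y (Some x)) \<partial>count_space UNIV)
    = (\<integral>\<^sup>+y. ennreal (pmf \<mu> (Some x) * exp (- (t / \<gamma> x))) * indicator {Some x} y
        + ennreal (lam x) * (ennreal (pmf \<mu> y) * discounted_occupation y x t) \<partial>count_space UNIV)"
    unfolding trans_prob_Some[OF t]
    by (intro nn_integral_cong) (auto simp: distrib_left ennreal_mult ac_simps)
  also have "\<dots> = ennreal (pmf \<mu> (Some x) * exp (- (t / \<gamma> x))) + ennreal (lam x) * mixed_discounted_occupation \<mu> x t"
    unfolding mixed_discounted_occupation_def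
    by (subst nn_integral_add) (auto simp: nn_integral_cmult_indicator nn_integral_cmult)
  finally show ?thesis .
qed

text \<open>The mass of the extra point is determined by total mass one, so its equation follows from those of the ordinary states.\<close>

lemma invariant_from_states:
  assumes Some: "\<And>t x. 0 < t \<Longrightarrow>
    (\<integral>\<^sup>+y. ennreal (pmf \<mu> y) * ennreal (p t y (Some x)) \<partial>count_space UNIV) = ennreal (pmf \<mu> (Some x))"
  shows "invariant_pmf p \<mu>"
  unfolding invariant_iff
proof (intro allI impI)
  fix t :: real and z :: "'s option" assume t: "0 < t"
  show "(\<integral>\<^sup>+y. ennreal (pmf \<mu> y) * ennreal (p t y z) \<partial>count_space UNIV) = ennreal (pmf \<mu> z)"
  proof (cases z)
    case None
    let ?m = "\<lambda>z. \<integral>\<^sup>+y. ennreal (pmf \<mu> y) * ennreal (p t y z) \<partial>count_space UNIV"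
    have one: "(\<integral>\<^sup>+z. ennreal (pmf \<mu> z) \<partial>count_space UNIV) = 1"
      by (simp add: nn_integral_pmf measure_pmf.emeasure_space_1)
    have "(\<integral>\<^sup>+z. ?m z \<partial>count_space UNIV)
        = (\<integral>\<^sup>+y. \<integral>\<^sup>+z. ennreal (pmf \<mu> y) * ennreal (p t y z) \<partial>count_space UNIV \<partial>count_space UNIV)"
      by (intro nn_integral_count_space_nn_integral countable_option) simp
    also have "\<dots> = (\<integral>\<^sup>+z. ennreal (pmf \<mu> z) \<partial>count_space UNIV)"
      using trans_prob_total[of t] t by (simp add: nn_integral_cmult)
    finally have "?m None + (\<integral>\<^sup>+x. ?m (Some x) \<partial>count_space UNIV)
        = ennreal (pmf \<mu> None) + (\<integral>\<^sup>+x. ennreal (pmf \<mu> (Some x)) \<partial>count_space UNIV)"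
      by (simp only: nn_integral_count_space_option)
    moreover have "(\<integral>\<^sup>+x. ennreal (pmf \<mu> (Some x)) \<partial>count_space UNIV) \<noteq> \<infinity>"
      using one by (auto simp: nn_integral_count_space_option)
    ultimately show ?thesis
      unfolding None Some[OF t] by (rule ennreal_add_cancel_right[rotated])
  qed (use Some[OF t] in simp)
qed

definition total_rate :: real where
  "total_rate = c + (\<Sum>\<^sub>\<infinity>x\<in>UNIV. lam x * \<gamma> x)"

lemma total_rate_eq: "ennreal total_rate = ennreal c + (\<integral>\<^sup>+x. ennreal (lam x * \<gamma> x) \<partial>count_space UNIV)"
  unfolding rates_finite total_rate_def using c_nonneg lam_pos \<gamma>_pos
  by (intro ennreal_plus infsum_nonneg) (auto intro: less_imp_le)

lemma total_rate_pos: "0 < total_rate"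
proof -
  obtain x :: 's where True by auto
  have "0 < ennreal (lam x * \<gamma> x)" using lam_pos[of x] \<gamma>_pos[of x] by simp
  also have "\<dots> \<le> (\<integral>\<^sup>+x. ennreal (lam x * \<gamma> x) \<partial>count_space UNIV)"
    by (rule nn_integral_ge_point) simp
  also have "\<dots> \<le> ennreal total_rate" by (simp add: total_rate_eq)
  finally show ?thesis by simp
qed

definition equilibrium :: "'s option pmf" where
  "equilibrium = embed_pmf (\<lambda>y. (case y of None \<Rightarrow> c | Some x \<Rightarrow> lam x * \<gamma> x) / total_rate)"

lemma pmf_equilibrium:
  "pmf equilibrium y = (case y of None \<Rightarrow> c | Some x \<Rightarrow> lam x * \<gamma> x) / total_rate"
  unfolding equilibrium_def
proof (rule pmf_embed_pmf)
  show "0 \<le> (case y of None \<Rightarrow> c | Some x \<Rightarrow> lam x * \<gamma> x) / total_rate" for y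
    using c_nonneg lam_pos \<gamma>_pos total_rate_pos by (auto intro: less_imp_le split: option.split)
  have "(\<integral>\<^sup>+y. ennreal ((case y of None \<Rightarrow> c | Some x \<Rightarrow> lam x * \<gamma> x) / total_rate) \<partial>count_space UNIV)
    = ennreal c / ennreal total_rate + (\<integral>\<^sup>+x. ennreal (lam x * \<gamma> x) / ennreal total_rate \<partial>count_space UNIV)"
    using c_nonneg lam_pos \<gamma>_pos total_rate_pos
    by (simp add: nn_integral_count_space_option divide_ennreal less_imp_le)
  also have "\<dots> = ennreal total_rate / ennreal total_rate"
    unfolding total_rate_eq by (simp add: nn_integral_divide add_divide_distrib_ennreal)
  also have "\<dots> = 1" using total_rate_pos by (simp add: divide_ennreal)
  finally show "(\<integral>\<^sup>+y. ennreal ((case y of None \<Rightarrow> c | Some x \<Rightarrow> lam x * \<gamma> x) / total_rate) \<partial>count_space UNIV) = 1" .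
qed

text \<open>This is the time balance, divided by the total rate.\<close>

lemma equilibrium_occupation:
  assumes t: "0 \<le> t"
  shows "mixed_occupation equilibrium t = ennreal (t / total_rate)"
proof -
  have "mixed_occupation equilibrium t = ennreal (1 / total_rate) * (ennreal c * occupation None t
    + (\<integral>\<^sup>+x. ennreal (lam x * \<gamma> x) * occupation (Some x) t \<partial>count_space UNIV))"
  proof -
    have *: "ennreal (a / total_rate) = ennreal (1 / total_rate) * ennreal a" if "0 \<le> a" for a
      using total_rate_pos that by (simp flip: ennreal_mult)
    have 1: "ennreal (c / total_rate) = ennreal (1 / total_rate) * ennreal c"
      and 2: "ennreal (lam x * \<gamma> x / total_rate) = ennreal (1 / total_rate) * ennreal (lam x * \<gamma> x)" for x
      using c_nonneg lam_pos[of x] \<gamma>_pos[of x] by (auto intro!: *)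
    show ?thesis
      unfolding mixed_occupation_split pmf_equilibrium distrib_left
      by (simp add: 1 2 mult.assoc nn_integral_cmult)
  qed
  also have "\<dots> = ennreal (t / total_rate)"
    unfolding time_balance[OF t, symmetric] using t total_rate_pos by (simp flip: ennreal_mult)
  finally show ?thesis .
qed

lemma equilibrium_discounted_occupation:
  assumes t: "0 \<le> t"
  shows "mixed_discounted_occupation equilibrium x t = ennreal (\<gamma> x / total_rate * (1 - exp (- (t / \<gamma> x))))"
proof -
  have g: "0 < \<gamma> x" by (rule \<gamma>_pos)
  \<comment> \<open>An antiderivative of the integrand of the inverse relation.\<close>
  let ?F = "\<lambda>u. exp (- ((t - u) / \<gamma> x)) * (u - \<gamma> x) / total_rate"
  have "(\<integral>\<^sup>+u. indicator {0..t} u * ennreal (exp (- ((t - u) / \<gamma> x)) / \<gamma> x) * mixed_occupation equilibrium u \<partial>lborel)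
    = (\<integral>\<^sup>+u. ennreal (exp (- ((t - u) / \<gamma> x)) / \<gamma> x * (u / total_rate)) * indicator {0..t} u \<partial>lborel)"
    using g total_rate_pos
    by (intro nn_integral_cong) (auto simp: indicator_def equilibrium_occupation simp flip: ennreal_mult)
  also have "\<dots> = ennreal (?F t - ?F 0)"
    using g total_rate_pos t
    by (intro nn_integral_FTC_Icc) (auto intro!: derivative_eq_intros simp: field_simps)
  finally have 1: "mixed_discounted_occupation equilibrium x t + ennreal (?F t - ?F 0) = ennreal (t / total_rate)"
    using mixed_discounted_occupation_inverse_equation[OF t, of equilibrium x] equilibrium_occupation[OF t] by simp
  have e: "exp (- (t / \<gamma> x)) \<le> 1" using t g by simp
  have "ennreal (\<gamma> x / total_rate * (1 - exp (- (t / \<gamma> x)))) + ennreal (?F t - ?F 0) = ennreal (t / total_rate)"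
  proof (subst ennreal_plus[symmetric])
    show "0 \<le> \<gamma> x / total_rate * (1 - exp (- (t / \<gamma> x)))"
      using e g total_rate_pos by simp
    have "1 - t / \<gamma> x \<le> exp (- (t / \<gamma> x))" using exp_ge_add_one_self[of "- (t / \<gamma> x)"] by simp
    then have "\<gamma> x * (1 - t / \<gamma> x) \<le> \<gamma> x * exp (- (t / \<gamma> x))" using g by (intro mult_left_mono) auto
    then have "0 \<le> (t - \<gamma> x + \<gamma> x * exp (- (t / \<gamma> x))) / total_rate"
      using g total_rate_pos by (intro divide_nonneg_pos) (simp_all add: right_diff_distrib)
    also have "\<dots> = ?F t - ?F 0" by (simp add: diff_divide_distrib add_divide_distrib ac_simps)
    finally show "0 \<le> ?F t - ?F 0" .
    show "ennreal (\<gamma> x / total_rate * (1 - exp (- (t / \<gamma> x))) + (?F t - ?F 0)) = ennreal (t / total_rate)"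
      using total_rate_pos by (intro arg_cong[where f=ennreal]) (simp add: field_simps)
  qed
  from this[symmetric] show ?thesis
    by (intro ennreal_add_cancel_right[OF _ trans[OF 1]]) (rule ennreal_neq_top[folded infinity_ennreal_def])
qed

lemma equilibrium_invariant: "invariant_pmf p equilibrium"
proof (rule invariant_from_states)
  fix t :: real and x assume t: "0 < t"
  have e: "exp (- (t / \<gamma> x)) \<le> 1" using t \<gamma>_pos[of x] by simp
  have "ennreal (pmf equilibrium (Some x) * exp (- (t / \<gamma> x))) + ennreal (lam x) * mixed_discounted_occupation equilibrium x t
    = ennreal (lam x * \<gamma> x / total_rate * exp (- (t / \<gamma> x)) + lam x * (\<gamma> x / total_rate * (1 - exp (- (t / \<gamma> x)))))"
    using t e lam_pos[of x] \<gamma>_pos[of x] total_rate_pos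
    by (simp add: pmf_equilibrium equilibrium_discounted_occupation ennreal_mult[symmetric] ennreal_plus[symmetric] del: ennreal_plus)
  also have "\<dots> = ennreal (pmf equilibrium (Some x))"
    by (simp add: pmf_equilibrium right_diff_distrib diff_divide_distrib ac_simps)
  finally show "(\<integral>\<^sup>+y. ennreal (pmf equilibrium y) * ennreal (p t y (Some x)) \<partial>count_space UNIV)
      = ennreal (pmf equilibrium (Some x))"
    using t by (simp add: mixed_trans_prob_Some)
qed

text \<open>The equation for the state \<open>x\<close>, solved for the unknown mixture.\<close>

lemma invariant_discounted_occupation:
  assumes inv: "invariant_pmf p \<mu>" and t: "0 < t"
  shows "mixed_discounted_occupation \<mu> x t = ennreal (pmf \<mu> (Some x) / lam x * (1 - exp (- (t / \<gamma> x))))"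
proof -
  have l: "0 < lam x" by (rule lam_pos)
  have e: "exp (- (t / \<gamma> x)) \<le> 1" using t \<gamma>_pos[of x] by simp
  let ?a = "pmf \<mu> (Some x) * exp (- (t / \<gamma> x))" and ?b = "pmf \<mu> (Some x) * (1 - exp (- (t / \<gamma> x)))"
  have "ennreal ?a + ennreal (lam x) * mixed_discounted_occupation \<mu> x t = ennreal (pmf \<mu> (Some x))"
    using inv t mixed_trans_prob_Some[of t \<mu> x] unfolding invariant_iff by simp
  also have "\<dots> = ennreal ?a + ennreal ?b"
    using e by (subst ennreal_plus[symmetric]) (auto simp: right_diff_distrib mult_left_le)
  finally have eq: "ennreal (lam x) * mixed_discounted_occupation \<mu> x t = ennreal ?b"
    by (simp only: ennreal_add_left_cancel) simp
  have "mixed_discounted_occupation \<mu> x t = ennreal (1 / lam x) * (ennreal (lam x) * mixed_discounted_occupation \<mu> x t)"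
    using l by (simp add: mult.assoc[symmetric] ennreal_mult[symmetric])
  also have "\<dots> = ennreal (1 / lam x * ?b)"
    unfolding eq using l e by (intro ennreal_mult[symmetric]) auto
  finally show ?thesis by simp
qed

text \<open>The left-hand side does not mention \<open>x\<close>, which forces the masses to be proportional to
\<open>lam x * \<gamma> x\<close>.\<close>

lemma invariant_occupation:
  assumes inv: "invariant_pmf p \<mu>"
  shows "mixed_occupation \<mu> 1 = ennreal (pmf \<mu> (Some x) / (lam x * \<gamma> x))"
proof -
  have g: "0 < \<gamma> x" and l: "0 < lam x" by (rule \<gamma>_pos lam_pos)+
  let ?a = "pmf \<mu> (Some x) / lam x"
  \<comment> \<open>An antiderivative of the mixture, divided by \<open>\<gamma> x\<close>.\<close>
  let ?F = "\<lambda>u. ?a * (u / \<gamma> x + exp (- (u / \<gamma> x)))"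
  have "(\<integral>\<^sup>+u. indicator {0..1} u * ennreal (1 / \<gamma> x) * mixed_discounted_occupation \<mu> x u \<partial>lborel)
    = (\<integral>\<^sup>+u. ennreal (1 / \<gamma> x * (?a * (1 - exp (- (u / \<gamma> x))))) * indicator {0..1} u \<partial>lborel)"
  proof (intro nn_integral_cong_AE eventually_mono[OF AE_lborel_singleton[of 0]])
    fix u :: real assume "u \<noteq> 0"
    show "indicator {0..1} u * ennreal (1 / \<gamma> x) * mixed_discounted_occupation \<mu> x u
      = ennreal (1 / \<gamma> x * (?a * (1 - exp (- (u / \<gamma> x))))) * indicator {0..1} u"
    proof (cases "u \<in> {0..1}")
      case True
      then have "0 < u" using \<open>u \<noteq> 0\<close> by simp
      then have "ennreal (1 / \<gamma> x) * mixed_discounted_occupation \<mu> x u = ennreal (1 / \<gamma> x * (?a * (1 - exp (- (u / \<gamma> x)))))"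
        unfolding invariant_discounted_occupation[OF inv \<open>0 < u\<close>] using g l by (subst ennreal_mult) auto
      then show ?thesis using True by simp
    qed simp
  qed
  also have "\<dots> = ennreal (?F 1 - ?F 0)"
    using g l by (intro nn_integral_FTC_Icc) (auto intro!: derivative_eq_intros simp: field_simps mult_left_le)
  finally have "mixed_occupation \<mu> 1 = ennreal (?a * (1 - exp (- (1 / \<gamma> x)))) + ennreal (?F 1 - ?F 0)"
    using mixed_discounted_occupation_equation[of 1 \<mu> x] invariant_discounted_occupation[OF inv, of 1 x] by simp
  also have "\<dots> = ennreal (?a * (1 - exp (- (1 / \<gamma> x))) + (?F 1 - ?F 0))"
  proof (subst ennreal_plus)
    have "1 - 1 / \<gamma> x \<le> exp (- (1 / \<gamma> x))" using exp_ge_add_one_self[of "- (1 / \<gamma> x)"] by simp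
    then have "?a * 1 \<le> ?a * (1 / \<gamma> x + exp (- (1 / \<gamma> x)))" using l by (intro mult_left_mono) auto
    then show "0 \<le> ?F 1 - ?F 0" by simp
    show "0 \<le> ?a * (1 - exp (- (1 / \<gamma> x)))" using g l by simp
  qed simp
  also have "?a * (1 - exp (- (1 / \<gamma> x))) + (?F 1 - ?F 0) = pmf \<mu> (Some x) / (lam x * \<gamma> x)"
    by (simp add: algebra_simps)
  finally show ?thesis .
qed

text \<open>With \<open>\<kappa>\<close> the common ratio of \<open>\<mu> (Some x)\<close> and \<open>lam x * \<gamma> x\<close>, subtracting \<open>\<kappa>\<close> times the
time balance from the formula for the mixed occupation leaves \<open>(\<mu> None - \<kappa> * c) * occupation None 1 = 0\<close>. The
occupation is positive, since otherwise the time balance would read \<open>1 = 0\<close>.\<close>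

lemma invariant_unique:
  assumes inv: "invariant_pmf p \<mu>"
  shows "\<mu> = equilibrium"
proof -
  define \<kappa> where "\<kappa> = enn2real (mixed_occupation \<mu> 1)"
  have k0: "0 \<le> \<kappa>" by (simp add: \<kappa>_def)
  have S: "pmf \<mu> (Some x) = \<kappa> * (lam x * \<gamma> x)" for x
    unfolding \<kappa>_def invariant_occupation[OF inv, of x] using lam_pos[of x] \<gamma>_pos[of x] by simp
  obtain x0 :: 's where True by auto
  have W: "mixed_occupation \<mu> 1 = ennreal \<kappa>"
    unfolding \<kappa>_def invariant_occupation[OF inv, of x0] using lam_pos[of x0] \<gamma>_pos[of x0] by simp
  let ?J = "\<integral>\<^sup>+x. ennreal (lam x * \<gamma> x) * occupation (Some x) 1 \<partial>count_space UNIV"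
  have bal: "1 = ennreal c * occupation None 1 + ?J"
    using time_balance[of 1] by simp
  obtain o1 where o1: "occupation None 1 = ennreal o1" "0 \<le> o1"
    using occupation_finite[of 1 None] by (cases "occupation None 1") auto
  have "?J \<noteq> \<infinity>"
  proof
    assume "?J = \<infinity>"
    then have "ennreal c * occupation None 1 + ?J = \<infinity>" by simp
    then show False unfolding bal[symmetric] by simp
  qed
  then obtain J where J: "?J = ennreal J" "0 \<le> J" by (cases ?J) auto
  have bal': "1 = c * o1 + J"
    using bal o1 J c_nonneg by (simp flip: ennreal_mult ennreal_plus ennreal_1)
  have Jk: "(\<integral>\<^sup>+x. ennreal (pmf \<mu> (Some x)) * occupation (Some x) 1 \<partial>count_space UNIV) = ennreal \<kappa> * ?J"
  proof (subst nn_integral_cmult[symmetric])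
    have "ennreal (\<kappa> * (lam x * \<gamma> x)) = ennreal \<kappa> * ennreal (lam x * \<gamma> x)" for x
      using k0 lam_pos[of x] \<gamma>_pos[of x] by (intro ennreal_mult) auto
    then show "(\<integral>\<^sup>+x. ennreal (pmf \<mu> (Some x)) * occupation (Some x) 1 \<partial>count_space UNIV)
      = (\<integral>\<^sup>+x. ennreal \<kappa> * (ennreal (lam x * \<gamma> x) * occupation (Some x) 1) \<partial>count_space UNIV)"
      unfolding S by (simp only: mult.assoc)
  qed simp
  have "ennreal \<kappa> = ennreal (pmf \<mu> None) * ennreal o1 + ennreal \<kappa> * ennreal J"
    using mixed_occupation_split[of \<mu> 1] unfolding W Jk o1(1) J(1) .
  then have eq: "\<kappa> = pmf \<mu> None * o1 + \<kappa> * J"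
    using k0 o1 J by (simp flip: ennreal_mult ennreal_plus)
  have "o1 \<noteq> 0"
  proof
    assume "o1 = 0"
    then have "occupation (Some x) 1 = 0" for x
      using occupation_Some_le[of x 1] o1 by simp
    then have "?J = 0" by simp
    then show False using bal \<open>o1 = 0\<close> o1 by simp
  qed
  moreover have "(pmf \<mu> None - \<kappa> * c) * o1 = 0"
  proof -
    have c1: "c * o1 = 1 - J" using bal' by simp
    have "(pmf \<mu> None - \<kappa> * c) * o1 = pmf \<mu> None * o1 - \<kappa> * (c * o1)"
      by (simp add: algebra_simps)
    also have "\<dots> = 0" unfolding c1 using eq by (simp add: right_diff_distrib)
    finally show ?thesis .
  qed
  ultimately have N: "pmf \<mu> None = \<kappa> * c" by simp
  have "1 = (\<integral>\<^sup>+y. ennreal (pmf \<mu> y) \<partial>count_space UNIV)"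
    by (simp add: nn_integral_pmf measure_pmf.emeasure_space_1)
  also have "\<dots> = ennreal \<kappa> * ennreal total_rate"
    unfolding nn_integral_count_space_option N S total_rate_eq
    using k0 c_nonneg lam_pos \<gamma>_pos
    by (simp add: ennreal_mult less_imp_le nn_integral_cmult distrib_left)
  finally have "\<kappa> * total_rate = 1"
    using k0 total_rate_pos by (simp flip: ennreal_mult ennreal_1)
  then have "\<kappa> = 1 / total_rate" using total_rate_pos by (simp add: field_simps)
  then show ?thesis
    by (intro pmf_eqI) (auto simp: pmf_equilibrium N S split: option.split)
qed

end

theorem theorem5p11:
  fixes M :: "'w measure"
    and \<gamma> lam :: "'s \<Rightarrow> real"
    and c :: real
    and \<sigma> T :: "'s \<Rightarrow> nat \<Rightarrow> 'w \<Rightarrow> real"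
    and T0 :: "'w \<Rightarrow> real"
  assumes "countable (UNIV :: 's set)" and "infinite (UNIV :: 's set)"
    and "\<And>x. \<gamma> x > 0" and "\<And>x. lam x > 0" and "c \<ge> 0"
    and "\<not> lam summable_on UNIV"
    and "(\<lambda>x. lam x * \<gamma> x) summable_on UNIV"
    and "prob_space M"
    and "k_process_inputs M lam \<sigma> T0 T"
  shows "\<exists>\<pi>. invariant_pmf (trans_prob M \<gamma> c \<sigma> T0 T) \<pi>
    \<and> (\<forall>\<mu>. invariant_pmf (trans_prob M \<gamma> c \<sigma> T0 T) \<mu> \<longrightarrow> \<mu> = \<pi>)
    \<and> (\<forall>x. pmf \<pi> (Some x) = lam x * \<gamma> x / (c + (\<Sum>\<^sub>\<infinity>y\<in>UNIV. lam y * \<gamma> y)))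
    \<and> pmf \<pi> None = c / (c + (\<Sum>\<^sub>\<infinity>y\<in>UNIV. lam y * \<gamma> y))"
proof -
  interpret prob_space M by fact
  interpret k_process_setting M \<gamma> lam c \<sigma> T T0
    by unfold_locales (fact assms)+
  show ?thesis
  proof (intro exI[of _ equilibrium] conjI allI impI)
    show "invariant_pmf p equilibrium" by (rule equilibrium_invariant)
    show "\<mu> = equilibrium" if "invariant_pmf p \<mu>" for \<mu>
      using that by (rule invariant_unique)
  qed (simp_all add: pmf_equilibrium total_rate_def)
qed

end
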